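(* Let $G=(X,E)$ be a graph (simple, reflexive, with arbitrary, possibly infinite, vertex set $X$), and let $(X,c_X)$ be the induced Čech closure space, regarded as a pretopological space. Then the geometric realization $|\mathbf K(X)|$ of the clique complex of $G$ and $(X,c_X)$ are weakly homotopy equivalent (in the sense of pseudotopological spaces).
   Context: Pseudotopological spaces. For a set $X$ let $\mathrm{Fil}(X)$ be the set of (proper) filters on $X$. A pseudotopological space is a pair $(X,\lambda)$ with $\lambda:X\to 2^{\mathrm{Fil}(X)}$ such that for every $x$: (1) the principal ultrafilter at $x$ is in $\lambda(x)$; (2) $\mathcal F,\mathcal G\in\lambda(x)$ implies $\mathcal F\cap\mathcal G\in\lambda(x)$; (3) $\mathcal F\in\lambda(x)$ and $\mathcal F\subset\mathcal G$ implies $\mathcal G\in\lambda(x)$; (4) $\mathcal F\in\lambda(x)$ whenever every ultrafilter finer than $\mathcal F$ is in $\lambda(x)$. Members of $\lambda(x)$ are said to converge to $x$. The space is pretopological if moreover the intersection $\mathcal U_x$ of all filters in $\lambda(x)$ (the neighborhood filter at $x$) belongs to $\lambda(x)$; so a pretopological space is determined by its neighborhood filters. A map $f$ is continuous if $\mathcal F\to x$ implies $f(\mathcal F)\to f(x)$, where $f(\mathcal F)$ is the filter generated by the images. For pretopological spaces this means $\mathcal U_{f(x)}\subset f(\mathcal U_x)$. Topological spaces are regarded as pretopological spaces via their neighborhood filters. In a product a filter converges iff its two projections converge. Homotopy. Continuous $f,g:X\to Y$ are homotopic ($f\simeq g$) if there is a continuous $H:X\times I\to Y$, $I=[0,1]$,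 with $H(\cdot,0)=f$, $H(\cdot,1)=g$. For $n\ge 0$, $\pi_n(X,* )$ is the set of based homotopy classes of continuous based maps $(S^n,* )\to(X,* )$; it is a group for $n\geq 1$ with the usual operation. A continuous map $f:X\to Y$ is a weak homotopy equivalence if $\pi_n(f):\pi_n(X,* )\to\pi_n(Y,f( * ))$ is an isomorphism (a bijection if $n=0$) for every $n\ge0$ and every base point. Pseudotopological spaces $X,Y$ are weakly homotopy equivalent if there is a weak homotopy equivalence $X\to Y$ or $Y\to X$. Graphs. A graph $(X,E)$ is simple (no multiple edges, undirected) and reflexive ($(x,x)\in E$ for all $x\in X$). Its canonical closure operator is $c_X(x)=\{y\in X: (x,y)\in E\}$, $c_X(A)=\bigcup_{x\in A}c_X(x)$; the corresponding pretopology on $X$ has as neighborhood filter at $x$ the filter of all supersets of $c_X(x)$. The clique complex $\mathbf K(X)$ is the simplicial complex on $X$ whose simplices are the finite nonempty sets of pairwise adjacent vertices; $|\mathbf K(X)|$ is its geometric realization with the usual (weak) topology. *)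

theory Defs
  imports "HOL-Analysis.Analysis" "HOL-Algebra.Group"
begin

section \<open>Pseudotopological spaces\<close>

text \<open>
  A filter on a set \<open>A\<close> is represented by a filter on the ambient type that contains \<open>A\<close>,
  i.e. some \<open>F \<le> principal A\<close>.  In the order of the library, \<open>F \<le> G\<close> means that
  \<open>F\<close> is \<^emph>\<open>finer\<close> than \<open>G\<close>, \<open>bot\<close> is the improper filter, \<open>sup F G\<close> is the
  set-theoretic intersection of \<open>F\<close> and \<open>G\<close>, and \<open>principal {x}\<close> is the principal
  ultrafilter at \<open>x\<close>.
\<close>

definition ultrafilter :: "'a filter \<Rightarrow> bool" where
  "ultrafilter F \<longleftrightarrow> F \<noteq> bot \<and> (\<forall>P. eventually P F \<or> eventually (\<lambda>x. \<not> P x) F)"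

definition filters_on :: "'a set \<Rightarrow> 'a filter set" where
  "filters_on A = {F. F \<noteq> bot \<and> F \<le> principal A}"

record 'a pspace =
  points :: "'a set"
  lims :: "'a \<Rightarrow> 'a filter set"

definition pseudotopological_space :: "'a pspace \<Rightarrow> bool" where
  "pseudotopological_space S \<longleftrightarrow> (\<forall>x\<in>points S.
     lims S x \<subseteq> filters_on (points S) \<and>
     principal {x} \<in> lims S x \<and>
     (\<forall>F G. F \<in> lims S x \<and> G \<in> lims S x \<longrightarrow> sup F G \<in> lims S x) \<and>
     (\<forall>F G. F \<in> lims S x \<and> G \<in> filters_on (points S) \<and> G \<le> F \<longrightarrow> G \<in> lims S x) \<and>
     (\<forall>F. F \<in> filters_on (points S) \<and> (\<forall>U. ultrafilter U \<and> U \<le> F \<longrightarrow> U \<in> lims S x)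
          \<longrightarrow> F \<in> lims S x))"

definition neighborhood_filter :: "'a pspace \<Rightarrow> 'a \<Rightarrow> 'a filter" where
  "neighborhood_filter S x = Sup (lims S x)"

definition pretopological_space :: "'a pspace \<Rightarrow> bool" where
  "pretopological_space S \<longleftrightarrow> pseudotopological_space S \<and>
     (\<forall>x\<in>points S. neighborhood_filter S x \<in> lims S x)"

definition pcontinuous :: "'a pspace \<Rightarrow> 'b pspace \<Rightarrow> ('a \<Rightarrow> 'b) \<Rightarrow> bool" where
  "pcontinuous S T f \<longleftrightarrow> f ` points S \<subseteq> points T \<and>
     (\<forall>x\<in>points S. \<forall>F\<in>lims S x. filtermap f F \<in> lims T (f x))"

definition prod_pspace :: "'a pspace \<Rightarrow> 'b pspace \<Rightarrow> ('a \<times> 'b) pspace" where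
  "prod_pspace S T =
     \<lparr>points = points S \<times> points T,
      lims = (\<lambda>(x, y). {F \<in> filters_on (points S \<times> points T).
                 filtermap fst F \<in> lims S x \<and> filtermap snd F \<in> lims T y})\<rparr>"

text \<open>The pretopological space with prescribed neighborhood filters.\<close>

definition pretop_of :: "'a set \<Rightarrow> ('a \<Rightarrow> 'a filter) \<Rightarrow> 'a pspace" where
  "pretop_of A N = \<lparr>points = A, lims = (\<lambda>x. {F \<in> filters_on A. F \<le> N x})\<rparr>"

definition pspace_of_topology :: "'a topology \<Rightarrow> 'a pspace" where
  "pspace_of_topology T = pretop_of (topspace T) (nhdsin T)"

abbreviation unit_interval :: "real pspace" where
  "unit_interval \<equiv> pspace_of_topology (top_of_set {0..1})"


section \<open>Homotopy sets and groups\<close>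

definition based_maps :: "'a pspace \<Rightarrow> 'a \<Rightarrow> 'b pspace \<Rightarrow> 'b \<Rightarrow> ('a \<Rightarrow> 'b) set" where
  "based_maps S a T b = {f. pcontinuous S T f \<and> f a = b}"

text \<open>
  Maps are total functions on the ambient type.  Maps that agree on \<open>points S\<close> are related by
  \<open>based_homotopy_rel\<close>, so their values elsewhere play no role in the quotient.
\<close>

definition based_homotopy_rel ::
    "'a pspace \<Rightarrow> 'a \<Rightarrow> 'b pspace \<Rightarrow> 'b \<Rightarrow> (('a \<Rightarrow> 'b) \<times> ('a \<Rightarrow> 'b)) set" where
  "based_homotopy_rel S a T b =
     {(f, g). f \<in> based_maps S a T b \<and> g \<in> based_maps S a T b \<and>
        (\<exists>H. pcontinuous (prod_pspace S unit_interval) T H \<and>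
             (\<forall>x\<in>points S. H (x, 0) = f x \<and> H (x, 1) = g x) \<and>
             (\<forall>t\<in>{0..1}. H (a, t) = b))}"

abbreviation sphere_pspace :: "nat \<Rightarrow> (nat \<Rightarrow> real) pspace" where
  "sphere_pspace n \<equiv> pspace_of_topology (nsphere n)"

definition sphere_base :: "nat \<Rightarrow> real" where
  "sphere_base = (\<lambda>i. if i = 0 then 1 else 0)"

abbreviation sphere_maps :: "nat \<Rightarrow> 'a pspace \<Rightarrow> 'a \<Rightarrow> ((nat \<Rightarrow> real) \<Rightarrow> 'a) set" where
  "sphere_maps n S a \<equiv> based_maps (sphere_pspace n) sphere_base S a"

definition homotopy_class ::
    "nat \<Rightarrow> 'a pspace \<Rightarrow> 'a \<Rightarrow> ((nat \<Rightarrow> real) \<Rightarrow> 'a) \<Rightarrow> ((nat \<Rightarrow> real) \<Rightarrow> 'a) set" where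
  "homotopy_class n S a f = based_homotopy_rel (sphere_pspace n) sphere_base S a `` {f}"

definition homotopy_set :: "nat \<Rightarrow> 'a pspace \<Rightarrow> 'a \<Rightarrow> ((nat \<Rightarrow> real) \<Rightarrow> 'a) set set" where
  "homotopy_set n S a =
     sphere_maps n S a // based_homotopy_rel (sphere_pspace n) sphere_base S a"

text \<open>
  The pinch map of the \<open>n\<close>-sphere, \<open>n \<ge> 1\<close>.  It sends the equator \<open>x 1 = 0\<close> to the base point,
  and each of the open hemispheres \<open>x 1 > 0\<close> and \<open>x 1 < 0\<close> homeomorphically, and preserving the
  orientation, onto the complement of the base point.  So applying it and remembering the hemisphere
  is the usual map from the sphere to the wedge of two copies of it.
  For \<open>n = 1\<close> it is \<open>z \<mapsto> z\<^sup>2\<close> on the unit circle, and \<open>sphere_mult\<close> is the concatenation of loops.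
\<close>

definition sphere_pinch :: "(nat \<Rightarrow> real) \<Rightarrow> (nat \<Rightarrow> real)" where
  "sphere_pinch x = (\<lambda>i. if i = 0 then 1 - 2 * (x 1)\<^sup>2
                         else if i = 1 then 2 * x 0 * x 1
                         else 2 * \<bar>x 1\<bar> * x i)"

definition sphere_mult ::
    "((nat \<Rightarrow> real) \<Rightarrow> 'a) \<Rightarrow> ((nat \<Rightarrow> real) \<Rightarrow> 'a) \<Rightarrow> (nat \<Rightarrow> real) \<Rightarrow> 'a" where
  "sphere_mult f g x = (if x 1 \<ge> 0 then f (sphere_pinch x) else g (sphere_pinch x))"

text \<open>
  Operations on classes are written as unions over all representatives; the classes in the union
  coincide.  The multiplication is meaningful for \<open>n \<ge> 1\<close> only.
\<close>

definition homotopy_group ::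
    "nat \<Rightarrow> 'a pspace \<Rightarrow> 'a \<Rightarrow> ((nat \<Rightarrow> real) \<Rightarrow> 'a) set monoid" where
  "homotopy_group n S a =
     \<lparr>carrier = homotopy_set n S a,
      mult = (\<lambda>A B. \<Union>f\<in>A. \<Union>g\<in>B. homotopy_class n S a (sphere_mult f g)),
      one = homotopy_class n S a (\<lambda>x. a)\<rparr>"

definition homotopy_induced ::
    "nat \<Rightarrow> 'b pspace \<Rightarrow> 'a \<Rightarrow> ('a \<Rightarrow> 'b) \<Rightarrow>
     ((nat \<Rightarrow> real) \<Rightarrow> 'a) set \<Rightarrow> ((nat \<Rightarrow> real) \<Rightarrow> 'b) set" where
  "homotopy_induced n T a f A = (\<Union>g\<in>A. homotopy_class n T (f a) (f \<circ> g))"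

definition weak_homotopy_equivalence :: "'a pspace \<Rightarrow> 'b pspace \<Rightarrow> ('a \<Rightarrow> 'b) \<Rightarrow> bool" where
  "weak_homotopy_equivalence S T f \<longleftrightarrow> pcontinuous S T f \<and>
     (\<forall>a\<in>points S.
        bij_betw (homotopy_induced 0 T a f) (homotopy_set 0 S a) (homotopy_set 0 T (f a)) \<and>
        (\<forall>n\<ge>1. homotopy_induced n T a f \<in> iso (homotopy_group n S a) (homotopy_group n T (f a))))"

definition weakly_homotopy_equivalent :: "'a pspace \<Rightarrow> 'b pspace \<Rightarrow> bool" where
  "weakly_homotopy_equivalent S T \<longleftrightarrow>
     pseudotopological_space S \<and> pseudotopological_space T \<and>
     ((\<exists>f. weak_homotopy_equivalence S T f) \<or> (\<exists>g. weak_homotopy_equivalence T S g))"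


section \<open>Graphs and clique complexes\<close>

definition reflexive_graph :: "'v set \<Rightarrow> ('v \<times> 'v) set \<Rightarrow> bool" where
  "reflexive_graph X E \<longleftrightarrow> E \<subseteq> X \<times> X \<and> refl_on X E \<and> sym E"

definition graph_closure :: "('v \<times> 'v) set \<Rightarrow> 'v set \<Rightarrow> 'v set" where
  "graph_closure E A = (\<Union>x\<in>A. {y. (x, y) \<in> E})"

definition graph_pspace :: "'v set \<Rightarrow> ('v \<times> 'v) set \<Rightarrow> 'v pspace" where
  "graph_pspace X E = pretop_of X (\<lambda>x. principal (graph_closure E {x}))"

definition clique_complex :: "'v set \<Rightarrow> ('v \<times> 'v) set \<Rightarrow> 'v set set" where
  "clique_complex X E =
     {\<sigma>. \<sigma> \<subseteq> X \<and> finite \<sigma> \<and> \<sigma> \<noteq> {} \<and> (\<forall>x\<in>\<sigma>. \<forall>y\<in>\<sigma>. (x, y) \<in> E)}"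

text \<open>
  The geometric realization in barycentric coordinates, for a family \<open>K\<close> of finite sets.
  A closed simplex carries its Euclidean topology, that is, the one
  induced by the product topology because only finitely many coordinates vary on it.
\<close>

definition closed_simplex :: "'v set \<Rightarrow> ('v \<Rightarrow> real) set" where
  "closed_simplex \<sigma> = {t. (\<forall>v. 0 \<le> t v) \<and> (\<forall>v. v \<notin> \<sigma> \<longrightarrow> t v = 0) \<and> (\<Sum>v\<in>\<sigma>. t v) = 1}"

definition geometric_realization :: "'v set set \<Rightarrow> ('v \<Rightarrow> real) topology" where
  "geometric_realization K = topology (\<lambda>U. U \<subseteq> (\<Union>\<sigma>\<in>K. closed_simplex \<sigma>) \<and>
     (\<forall>\<sigma>\<in>K. openin (subtopology (powertop_real UNIV) (closed_simplex \<sigma>))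
                      (U \<inter> closed_simplex \<sigma>)))"


section \<open>Well-definedness\<close>

lemma openin_geometric_realization:
  "openin (geometric_realization K) U \<longleftrightarrow> U \<subseteq> (\<Union>\<sigma>\<in>K. closed_simplex \<sigma>) \<and>
     (\<forall>\<sigma>\<in>K. openin (subtopology (powertop_real UNIV) (closed_simplex \<sigma>))
                      (U \<inter> closed_simplex \<sigma>))"
proof -
  let ?c = "closed_simplex :: 'a set \<Rightarrow> ('a \<Rightarrow> real) set"
  let ?open = "\<lambda>\<sigma>. openin (subtopology (powertop_real UNIV) (?c \<sigma>))"
  have int: "?open \<sigma> (S \<inter> T \<inter> ?c \<sigma>)" if "?open \<sigma> (S \<inter> ?c \<sigma>)" "?open \<sigma> (T \<inter> ?c \<sigma>)" for \<sigma> S T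
    using openin_Int[OF that] by (simp add: Int_ac)
  have un: "?open \<sigma> (\<Union>\<K> \<inter> ?c \<sigma>)" if "\<And>S. S \<in> \<K> \<Longrightarrow> ?open \<sigma> (S \<inter> ?c \<sigma>)" for \<sigma> \<K>
  proof -
    have "?open \<sigma> (\<Union>((\<lambda>S. S \<inter> ?c \<sigma>) ` \<K>))"
      using that by (intro openin_Union) blast
    moreover have "\<Union>((\<lambda>S. S \<inter> ?c \<sigma>) ` \<K>) = \<Union>\<K> \<inter> ?c \<sigma>"
      by blast
    ultimately show ?thesis
      by simp
  qed
  have "istopology (\<lambda>U. U \<subseteq> (\<Union>\<sigma>\<in>K. ?c \<sigma>) \<and> (\<forall>\<sigma>\<in>K. ?open \<sigma> (U \<inter> ?c \<sigma>)))"
    unfolding istopology_def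
  proof (intro conjI allI impI ballI)
    fix \<K> \<sigma>
    assume "\<forall>S\<in>\<K>. S \<subseteq> (\<Union>\<sigma>\<in>K. ?c \<sigma>) \<and> (\<forall>\<sigma>\<in>K. ?open \<sigma> (S \<inter> ?c \<sigma>))" and "\<sigma> \<in> K"
    then show "?open \<sigma> (\<Union>\<K> \<inter> ?c \<sigma>)"
      by (intro un) simp
  qed (simp add: int, blast, simp add: int, blast)
  then show ?thesis
    by (simp add: geometric_realization_def)
qed

lemma topspace_geometric_realization:
  "topspace (geometric_realization K) = (\<Union>\<sigma>\<in>K. closed_simplex \<sigma>)"
proof -
  have "openin (geometric_realization K) (\<Union>\<sigma>\<in>K. closed_simplex \<sigma>)"
    unfolding openin_geometric_realization
  proof (intro conjI ballI)
    fix \<sigma> assume "\<sigma> \<in> K"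
    then have "(\<Union>\<sigma>\<in>K. closed_simplex \<sigma>) \<inter> closed_simplex \<sigma>
        = topspace (subtopology (powertop_real UNIV) (closed_simplex \<sigma>))"
      by auto
    then show "openin (subtopology (powertop_real UNIV) (closed_simplex \<sigma>))
        ((\<Union>\<sigma>\<in>K. closed_simplex \<sigma>) \<inter> closed_simplex \<sigma>)"
      by (metis openin_topspace)
  qed simp
  then show ?thesis
    by (metis openin_geometric_realization openin_subset openin_topspace subset_antisym)
qed

lemma ultrafilter_le_exists:
  fixes F :: "'a filter"
  assumes F: "F \<noteq> bot"
  shows "\<exists>U\<le>F. ultrafilter U"
proof -
  let ?R = "{(b, a). a \<noteq> bot \<and> a \<le> b \<and> b \<le> F}"
  have nb: "c \<in> Chains ?R \<Longrightarrow> bot \<notin> c" for c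
    by (auto simp: Chains_def)
  have Fd: "Field ?R = {G. G \<noteq> bot \<and> G \<le> F}"
    by (auto simp: Field_def bot_unique)
  have "\<exists>m\<in>Field ?R. \<forall>a\<in>Field ?R. (m, a) \<in> ?R \<longrightarrow> a = m"
  proof (rule Zorns_po_lemma)
    show "Partial_order ?R"
      by (auto simp: partial_order_on_def preorder_on_def
          antisym_def refl_on_def trans_def Field_def bot_unique)
    show "\<exists>u\<in>Field ?R. \<forall>a\<in>C. (a, u) \<in> ?R" if C: "C \<in> Chains ?R" for C
    proof (cases "C = {}")
      case True
      then show ?thesis using F unfolding Fd by auto
    next
      case False
      from C False have "Inf C = bot \<longleftrightarrow> (\<exists>x\<in>C. x = bot)"
        unfolding trivial_limit_def by (intro eventually_Inf_base) (auto simp: Chains_def)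
      then have 1: "Inf C \<noteq> bot"
        using nb[OF C] by blast
      from False obtain x where x: "x \<in> C" by auto
      have le: "y \<le> F" if "y \<in> C" for y
        using C that by (auto simp: Chains_def)
      have 2: "Inf C \<le> F"
        using x le by (meson Inf_lower2)
      show ?thesis
        unfolding Fd using 1 2 le by (intro bexI[of _ "Inf C"]) (auto intro: Inf_lower)
    qed
  qed
  then obtain U where U: "U \<noteq> bot" "U \<le> F"
    and max: "\<And>G. G \<noteq> bot \<Longrightarrow> G \<le> U \<Longrightarrow> G = U"
    unfolding Fd by auto
  have "eventually P U \<or> eventually (\<lambda>x. \<not> P x) U" for P
  proof (rule disjCI)
    assume "\<not> eventually (\<lambda>x. \<not> P x) U"
    then have "inf U (principal {x. P x}) \<noteq> bot"
      by (simp add: trivial_limit_def eventually_inf_principal)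
    then have "inf U (principal {x. P x}) = U"
      by (rule max) simp
    then have "U \<le> principal {x. P x}"
      by (metis inf_le2)
    then show "eventually P U"
      by (simp add: le_principal)
  qed
  with U show ?thesis
    by (auto simp: ultrafilter_def)
qed

lemma le_if_ultrafilters_le:
  assumes "\<And>U. ultrafilter U \<Longrightarrow> U \<le> F \<Longrightarrow> U \<le> G"
  shows "F \<le> G"
proof (rule filter_leI, rule ccontr)
  fix P assume P: "eventually P G" "\<not> eventually P F"
  then have "inf F (principal {x. \<not> P x}) \<noteq> bot"
    by (simp add: trivial_limit_def eventually_inf_principal)
  then obtain U where U: "U \<le> inf F (principal {x. \<not> P x})" "ultrafilter U"
    using ultrafilter_le_exists by blast
  then have "U \<le> G" "U \<le> principal {x. \<not> P x}"
    using assms by auto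
  then have "eventually (\<lambda>x. P x \<and> \<not> P x) U"
    using filter_leD[OF _ P(1)] by (intro eventually_conj) (auto simp: le_principal)
  then show False
    using U(2) by (simp add: ultrafilter_def trivial_limit_def)
qed

lemma pseudotopological_spaceI:
  assumes "\<And>x F. x \<in> points S \<Longrightarrow> F \<in> lims S x \<Longrightarrow> F \<in> filters_on (points S)"
    and "\<And>x. x \<in> points S \<Longrightarrow> principal {x} \<in> lims S x"
    and "\<And>x F G. x \<in> points S \<Longrightarrow> F \<in> lims S x \<Longrightarrow> G \<in> lims S x \<Longrightarrow> sup F G \<in> lims S x"
    and "\<And>x F G. x \<in> points S \<Longrightarrow> F \<in> lims S x \<Longrightarrow> G \<in> filters_on (points S) \<Longrightarrow> G \<le> F
           \<Longrightarrow> G \<in> lims S x"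
    and "\<And>x F. x \<in> points S \<Longrightarrow> F \<in> filters_on (points S) \<Longrightarrow>
           (\<And>U. ultrafilter U \<Longrightarrow> U \<le> F \<Longrightarrow> U \<in> lims S x) \<Longrightarrow> F \<in> lims S x"
  shows "pseudotopological_space S"
  unfolding pseudotopological_space_def
proof (intro ballI conjI allI impI subsetI)
  fix x F assume "x \<in> points S"
    and "F \<in> filters_on (points S) \<and> (\<forall>U. ultrafilter U \<and> U \<le> F \<longrightarrow> U \<in> lims S x)"
  then show "F \<in> lims S x"
    using assms(5)[of x F] by simp
next
  fix x F G assume "x \<in> points S" "F \<in> lims S x \<and> G \<in> filters_on (points S) \<and> G \<le> F"
  then show "G \<in> lims S x"
    using assms(4)[of x F G] by simp
qed (simp_all add: assms(1-3))

lemma pseudotopologicalD: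
  assumes "pseudotopological_space S" "x \<in> points S"
  shows "F \<in> lims S x \<Longrightarrow> F \<in> filters_on (points S)"
    and "principal {x} \<in> lims S x"
    and "F \<in> lims S x \<Longrightarrow> G \<in> lims S x \<Longrightarrow> sup F G \<in> lims S x"
    and "F \<in> lims S x \<Longrightarrow> G \<noteq> bot \<Longrightarrow> G \<le> F \<Longrightarrow> G \<in> lims S x"
    and "F \<in> filters_on (points S) \<Longrightarrow> (\<And>U. ultrafilter U \<Longrightarrow> U \<le> F \<Longrightarrow> U \<in> lims S x)
           \<Longrightarrow> F \<in> lims S x"
proof -
  note * = bspec[OF assms(1)[unfolded pseudotopological_space_def] assms(2)]
  note 2 = *[THEN conjunct2, THEN conjunct2]
  note 3 = 2[THEN conjunct2]
  show 1: "F \<in> lims S x \<Longrightarrow> F \<in> filters_on (points S)" for F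
    by (rule *[THEN conjunct1, THEN subsetD])
  show "principal {x} \<in> lims S x"
    by (rule *[THEN conjunct2, THEN conjunct1])
  show "F \<in> lims S x \<Longrightarrow> G \<in> lims S x \<Longrightarrow> sup F G \<in> lims S x"
    by (rule 2[THEN conjunct1, rule_format]) (rule conjI)
  show "G \<in> lims S x" if "F \<in> lims S x" "G \<noteq> bot" "G \<le> F"
  proof -
    have "G \<in> filters_on (points S)"
      using 1[OF that(1)] that(2) order_trans[OF that(3)] by (simp add: filters_on_def)
    with that show ?thesis
      by (intro 3[THEN conjunct1, rule_format, of F]) simp
  qed
  show "F \<in> lims S x"
    if "F \<in> filters_on (points S)" "\<And>U. ultrafilter U \<Longrightarrow> U \<le> F \<Longrightarrow> U \<in> lims S x"
    using that by (intro 3[THEN conjunct2, rule_format, of F]) simp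
qed

lemma pretopological_pretop_of:
  assumes "\<And>x. x \<in> A \<Longrightarrow> principal {x} \<le> N x" "\<And>x. x \<in> A \<Longrightarrow> N x \<le> principal A"
  shows "pretopological_space (pretop_of A N)"
    and "x \<in> A \<Longrightarrow> neighborhood_filter (pretop_of A N) x = N x"
proof -
  have pts: "points (pretop_of A N) = A"
    and lims: "F \<in> lims (pretop_of A N) x \<longleftrightarrow> F \<in> filters_on A \<and> F \<le> N x" for F x
    by (simp_all add: pretop_of_def)
  have mem: "N x \<in> lims (pretop_of A N) x" if "x \<in> A" for x
    using assms[OF that] by (auto simp: lims filters_on_def principal_eq_bot_iff bot_unique)
  show nf: "neighborhood_filter (pretop_of A N) x = N x" if "x \<in> A" for x
    unfolding neighborhood_filter_def
    by (rule antisym, rule Sup_least, simp add: lims, rule Sup_upper, rule mem[OF that])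
  have "pseudotopological_space (pretop_of A N)"
  proof (rule pseudotopological_spaceI, unfold pts lims)
    fix x F
    assume F: "F \<in> filters_on A"
      and U: "\<And>U. ultrafilter U \<Longrightarrow> U \<le> F \<Longrightarrow> U \<in> filters_on A \<and> U \<le> N x"
    show "F \<in> filters_on A \<and> F \<le> N x"
      using F U le_if_ultrafilters_le[of F "N x"] by blast
  next
    fix x F G
    assume "F \<in> filters_on A \<and> F \<le> N x" "G \<in> filters_on A" "G \<le> F"
    then show "G \<in> filters_on A \<and> G \<le> N x"
      by (meson order_trans)
  qed (use assms in \<open>simp_all add: filters_on_def principal_eq_bot_iff\<close>)
  then show "pretopological_space (pretop_of A N)"
    using nf mem by (simp add: pretopological_space_def pts)
qed

lemma nhdsin_bounds:
  assumes "x \<in> topspace T"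
  shows "principal {x} \<le> nhdsin T x" "nhdsin T x \<le> principal (topspace T)"
  using assms by (auto simp: nhdsin_def intro!: INF_greatest INF_lower)

lemma pretopological_pspace_of_topology:
  "pretopological_space (pspace_of_topology T)"
  unfolding pspace_of_topology_def by (rule pretopological_pretop_of) (simp_all add: nhdsin_bounds)

lemma pretopological_graph_pspace:
  assumes "reflexive_graph X E"
  shows "pretopological_space (graph_pspace X E)"
  unfolding graph_pspace_def
  using assms by (intro pretopological_pretop_of)
    (auto simp: reflexive_graph_def graph_closure_def refl_on_def)

lemma pcontinuous_pspace_of_topology_iff:
  "pcontinuous (pspace_of_topology S) (pspace_of_topology T) f \<longleftrightarrow> continuous_map S T f"
proof -
  have nhd: "nhdsin S x \<in> filters_on (topspace S)" if "x \<in> topspace S" for x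
    using nhdsin_bounds[OF that] by (auto simp: filters_on_def principal_eq_bot_iff bot_unique)
  have lim: "limitin T f (f x) (nhdsin S x) \<longleftrightarrow> filtermap f (nhdsin S x) \<le> nhdsin T (f x)"
    if "f x \<in> topspace T" for x
    using that
    by (auto simp: limitin_def nhdsin_def le_INF_iff le_principal eventually_filtermap)
  show ?thesis (is "?L \<longleftrightarrow> ?R")
  proof
    assume L: ?L
    then have im: "f ` topspace S \<subseteq> topspace T"
      by (simp add: pcontinuous_def pspace_of_topology_def pretop_of_def)
    have "filtermap f (nhdsin S x) \<le> nhdsin T (f x)" if "x \<in> topspace S" for x
      using L that nhd[OF that] by (simp add: pcontinuous_def pspace_of_topology_def pretop_of_def)
    then have "limitin T f (f x) (nhdsin S x)" if "x \<in> topspace S" for x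
      using lim im that by blast
    then have *: "\<forall>U. openin T U \<and> f x \<in> U \<longrightarrow> (\<exists>V. openin S V \<and> x \<in> V \<and> (\<forall>y\<in>V. f y \<in> U))"
      if "x \<in> topspace S" for x
      using that by (auto simp: limitin_def eventually_nhdsin)
    show ?R
      unfolding continuous_map_eq_topcontinuous_at topcontinuous_at_def using im * by blast
  next
    assume R: ?R
    then have im: "f ` topspace S \<subseteq> topspace T"
      by (rule continuous_map_image_subset_topspace)
    have "filtermap f (nhdsin S x) \<le> nhdsin T (f x)" if x: "x \<in> topspace S" for x
    proof -
      have "f x \<in> topspace T" using im x by blast
      moreover have "limitin T f (f x) (nhdsin S x)"
        using R x im unfolding continuous_map_eq_topcontinuous_at topcontinuous_at_def
        by (auto simp: limitin_def eventually_nhdsin)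
      ultimately show ?thesis using lim by blast
    qed
    then have "filtermap f F \<le> nhdsin T (f x)" if "x \<in> topspace S" "F \<le> nhdsin S x" for x F
      using that filtermap_mono order_trans by blast
    then show ?L
      using im by (auto simp: pcontinuous_def pspace_of_topology_def pretop_of_def filters_on_def
          filtermap_bot_iff le_principal eventually_filtermap elim!: eventually_mono)
  qed
qed

lemma ultrafilter_filtermap:
  "ultrafilter U \<Longrightarrow> ultrafilter (filtermap f U)"
  by (auto simp: ultrafilter_def filtermap_bot_iff eventually_filtermap)

lemma ultrafilter_le_filtermap_lift:
  assumes "ultrafilter V" "V \<le> filtermap f F"
  shows "\<exists>U\<le>F. ultrafilter U \<and> filtermap f U = V"
proof -
  have "inf F (filtercomap f V) \<noteq> bot"
  proof
    assume "inf F (filtercomap f V) = bot"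
    then obtain P Q where P: "eventually P F" and Q: "eventually Q V"
      and PQ: "\<And>x. P x \<Longrightarrow> Q (f x) \<Longrightarrow> False"
      unfolding trivial_limit_def eventually_inf eventually_filtercomap by blast
    have "eventually (\<lambda>y. \<not> Q y) (filtermap f F)"
      unfolding eventually_filtermap using P by (rule eventually_mono) (use PQ in blast)
    then have "eventually (\<lambda>y. \<not> Q y) V"
      using assms(2) by (rule filter_leD[rotated])
    then have "eventually (\<lambda>y. \<not> Q y \<and> Q y) V"
      using Q by (rule eventually_conj)
    then show False
      using assms(1) by (simp add: ultrafilter_def trivial_limit_def)
  qed
  then obtain U where U: "U \<le> inf F (filtercomap f V)" "ultrafilter U"
    using ultrafilter_le_exists by blast
  then have le: "filtermap f U \<le> V"
    by (simp add: filtermap_le_iff_le_filtercomap)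
  have "V \<le> filtermap f U"
  proof (rule filter_leI)
    fix P assume P: "eventually P (filtermap f U)"
    show "eventually P V"
    proof (rule ccontr)
      assume "\<not> eventually P V"
      then have "eventually (\<lambda>x. \<not> P x) (filtermap f U)"
        using assms(1) le by (auto simp: ultrafilter_def filter_leD)
      with P have "eventually (\<lambda>x. P x \<and> \<not> P x) (filtermap f U)"
        by (rule eventually_conj)
      then show False
        using ultrafilter_filtermap[OF U(2), of f] by (simp add: ultrafilter_def trivial_limit_def)
    qed
  qed
  with U le show ?thesis by auto
qed

lemma pseudotopological_prod_pspace:
  assumes S: "pseudotopological_space S" and T: "pseudotopological_space T"
  shows "pseudotopological_space (prod_pspace S T)"
proof (rule pseudotopological_spaceI)
  fix z assume "z \<in> points (prod_pspace S T)"
  then obtain x y where z: "z = (x, y)" and x: "x \<in> points S" and y: "y \<in> points T"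
    by (auto simp: prod_pspace_def)
  have mem: "F \<in> lims (prod_pspace S T) z \<longleftrightarrow> F \<in> filters_on (points S \<times> points T) \<and>
      filtermap fst F \<in> lims S x \<and> filtermap snd F \<in> lims T y" for F
    by (simp add: prod_pspace_def z)
  have pts: "points (prod_pspace S T) = points S \<times> points T"
    by (simp add: prod_pspace_def)
  show "F \<in> filters_on (points (prod_pspace S T))" if "F \<in> lims (prod_pspace S T) z" for F
    using that unfolding mem pts by simp
  show "principal {z} \<in> lims (prod_pspace S T) z"
    using pseudotopologicalD(2)[OF S x] pseudotopologicalD(2)[OF T y] x y
    unfolding mem by (simp add: filters_on_def principal_eq_bot_iff filtermap_principal z)
  show "sup F G \<in> lims (prod_pspace S T) z"
    if "F \<in> lims (prod_pspace S T) z" "G \<in> lims (prod_pspace S T) z" for F G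
    using that pseudotopologicalD(3)[OF S x] pseudotopologicalD(3)[OF T y]
    unfolding mem by (simp add: filters_on_def filtermap_sup)
  show "G \<in> lims (prod_pspace S T) z"
    if F: "F \<in> lims (prod_pspace S T) z"
      and G: "G \<in> filters_on (points (prod_pspace S T))" "G \<le> F" for F G
  proof -
    have nb: "filtermap fst G \<noteq> bot" "filtermap snd G \<noteq> bot"
      using G by (simp_all add: filters_on_def filtermap_bot_iff)
    have "filtermap fst G \<in> lims S x"
      using pseudotopologicalD(4)[OF S x _ nb(1)] F filtermap_mono[OF G(2)] mem by blast
    moreover have "filtermap snd G \<in> lims T y"
      using pseudotopologicalD(4)[OF T y _ nb(2)] F filtermap_mono[OF G(2)] mem by blast
    ultimately show ?thesis
      using G unfolding mem pts by simp
  qed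
  show "F \<in> lims (prod_pspace S T) z"
    if F: "F \<in> filters_on (points (prod_pspace S T))"
      and U: "\<And>U. ultrafilter U \<Longrightarrow> U \<le> F \<Longrightarrow> U \<in> lims (prod_pspace S T) z" for F
  proof -
    have F': "F \<noteq> bot" "eventually (\<lambda>p. p \<in> points S \<times> points T) F"
      using F by (auto simp: filters_on_def pts le_principal)
    have "filtermap fst F \<in> filters_on (points S)" "filtermap snd F \<in> filters_on (points T)"
      using F' by (auto simp: filters_on_def filtermap_bot_iff le_principal eventually_filtermap
          elim: eventually_mono)
    moreover have "V \<in> lims S x" if "ultrafilter V" "V \<le> filtermap fst F" for V
      using ultrafilter_le_filtermap_lift[OF that] U mem by blast
    moreover have "V \<in> lims T y" if "ultrafilter V" "V \<le> filtermap snd F" for V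
      using ultrafilter_le_filtermap_lift[OF that] U mem by blast
    ultimately show ?thesis
      using F pseudotopologicalD(5)[OF S x] pseudotopologicalD(5)[OF T y] unfolding mem pts by simp
  qed
qed

lemma sphere_pinch_in_nsphere:
  assumes "n \<ge> 1" "x \<in> topspace (nsphere n)"
  shows "sphere_pinch x \<in> topspace (nsphere n)"
proof -
  obtain m where n: "n = Suc m"
    using assms(1) by (cases n) auto
  have split: "(\<Sum>i\<le>n. g i) = g 0 + g 1 + (\<Sum>i<m. g (Suc (Suc i)))" for g :: "nat \<Rightarrow> real"
    unfolding n lessThan_Suc_atMost[symmetric] sum.lessThan_Suc_shift by simp
  have sum1: "(x 0)\<^sup>2 + (x 1)\<^sup>2 + (\<Sum>i<m. (x (Suc (Suc i)))\<^sup>2) = 1"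
    and zero: "\<forall>i>n. x i = 0"
    using assms(2) split[of "\<lambda>i. (x i)\<^sup>2"] by (auto simp: nsphere)
  have "(\<Sum>i\<le>n. (sphere_pinch x i)\<^sup>2)
      = (1 - 2 * (x 1)\<^sup>2)\<^sup>2 + (2 * x 0 * x 1)\<^sup>2 + (\<Sum>i<m. (2 * \<bar>x 1\<bar> * x (Suc (Suc i)))\<^sup>2)"
    unfolding split by (simp add: sphere_pinch_def)
  also have "(\<Sum>i<m. (2 * \<bar>x 1\<bar> * x (Suc (Suc i)))\<^sup>2)
      = 4 * (x 1)\<^sup>2 * (\<Sum>i<m. (x (Suc (Suc i)))\<^sup>2)"
    by (simp add: power_mult_distrib sum_distrib_left)
  also have "(\<Sum>i<m. (x (Suc (Suc i)))\<^sup>2) = 1 - (x 0)\<^sup>2 - (x 1)\<^sup>2"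
    using sum1 by simp
  also have "(1 - 2 * (x 1)\<^sup>2)\<^sup>2 + (2 * x 0 * x 1)\<^sup>2 + 4 * (x 1)\<^sup>2 * (1 - (x 0)\<^sup>2 - (x 1)\<^sup>2) = 1"
    by (simp add: power2_eq_square algebra_simps)
  finally have "(\<Sum>i\<le>n. (sphere_pinch x i)\<^sup>2) = 1" .
  moreover have "\<forall>i>n. sphere_pinch x i = 0"
    using zero n by (auto simp: sphere_pinch_def)
  ultimately show ?thesis
    by (simp add: nsphere)
qed

lemma sphere_pinch_equator: "x 1 = 0 \<Longrightarrow> sphere_pinch x = sphere_base"
  unfolding sphere_pinch_def sphere_base_def by (rule ext) simp

lemma sphere_base_in_nsphere: "sphere_base \<in> topspace (nsphere n)"
proof -
  have "(\<Sum>i\<le>n. (sphere_base i)\<^sup>2) = (\<Sum>i\<in>{0}. (sphere_base i)\<^sup>2)"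
    by (rule sum.mono_neutral_right) (simp_all add: sphere_base_def)
  then show ?thesis
    by (simp add: nsphere sphere_base_def)
qed

end

theory Submission
  imports Defs
begin

text \<open>
  Choosing a vertex of the support of every point of the realization gives a continuous map
  \<open>\<phi>\<close> into the graph, since the points whose support contains a given simplex form an open set.

  Conversely, let \<open>G\<close> be a continuous map from a compact metric space to the graph.  Around every
  point \<open>s\<close> choose a radius \<open>r s\<close> such that \<open>G\<close> maps the ball of radius \<open>2 * r s\<close> into the
  neighbors of \<open>G s\<close>.  If the balls of radius \<open>r i\<close> and \<open>r j\<close> meet, then the center of the smaller
  one lies in the doubled larger one, so \<open>G i\<close> and \<open>G j\<close> are adjacent.  Hence a partition of unity
  subordinate to finitely many of these balls has the values of \<open>G\<close> at the centers as vertices of a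
  clique, and defines a map \<open>K\<close> into the realization.  Moreover \<open>\<phi> \<circ> K\<close> is homotopic to \<open>G\<close> by a
  homotopy that jumps at the last moment.

  If a map \<open>F\<close> into the realization is already given on a closed neighborhood \<open>N\<close> of a closed set,
  with \<open>G s\<close> in the support of \<open>F s\<close>, then smaller radii force the support of \<open>K s\<close> into that of
  \<open>F s\<close> on \<open>N\<close>, so that \<open>K\<close> can be interpolated linearly with \<open>F\<close>.  Applied to spheres, and to
  homotopies between spheres, this proves surjectivity and injectivity of \<open>\<pi>\<^sub>n(\<phi>)\<close>.
\<close>

section \<open>Continuity into pseudotopological spaces\<close>

lemma points_pspace_of_topology [simp]: "points (pspace_of_topology P) = topspace P"
  by (simp add: pspace_of_topology_def pretop_of_def)

lemma lims_pspace_of_topology: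
  "F \<in> lims (pspace_of_topology P) x \<longleftrightarrow> F \<noteq> bot \<and> F \<le> principal (topspace P) \<and> F \<le> nhdsin P x"
  by (simp add: pspace_of_topology_def pretop_of_def filters_on_def)

lemma pseudotopological_pspace_of_topology: "pseudotopological_space (pspace_of_topology P)"
  using pretopological_pspace_of_topology pretopological_space_def by blast

lemma pcontinuous_compose:
  "pcontinuous S T f \<Longrightarrow> pcontinuous T W g \<Longrightarrow> pcontinuous S W (g \<circ> f)"
  by (fastforce simp: pcontinuous_def filtermap_compose)

text \<open>Every convergent filter contains the space itself, so values elsewhere do not affect its
  image. In the pasting arguments this lets a map be replaced by a composition that agrees with it
  only on the space.\<close>

lemma pcontinuous_cong:
  assumes "\<And>x. x \<in> topspace P \<Longrightarrow> f x = g x"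
  shows "pcontinuous (pspace_of_topology P) T f \<longleftrightarrow> pcontinuous (pspace_of_topology P) T g"
proof -
  have "filtermap f F = filtermap g F" if "F \<in> lims (pspace_of_topology P) x" for F x
  proof -
    have "eventually (\<lambda>x. x \<in> topspace P) F"
      using that by (simp add: lims_pspace_of_topology le_principal)
    then show ?thesis
      unfolding filter_eq_iff eventually_filtermap
      by (intro allI eventually_subst) (auto elim!: eventually_mono simp: assms)
  qed
  then show ?thesis
    using assms unfolding pcontinuous_def by (auto simp: image_subset_iff)
qed

lemma pcontinuous_compose_continuous_map:
  "continuous_map P Q f \<Longrightarrow> pcontinuous (pspace_of_topology Q) T g
     \<Longrightarrow> pcontinuous (pspace_of_topology P) T (g \<circ> f)"
  using pcontinuous_compose pcontinuous_pspace_of_topology_iff by blast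

text \<open>Convergence to \<open>(x, y)\<close> in either structure means that \<open>fst\<close>
  tends to \<open>x\<close> and \<open>snd\<close> to \<open>y\<close> along the filter. Homotopies
  thereby become maps on an ordinary topological product.\<close>

lemma prod_pspace_of_topology:
  "prod_pspace (pspace_of_topology P) (pspace_of_topology Q)
     = pspace_of_topology (prod_topology P Q)"
proof -
  have "F \<in> lims (prod_pspace (pspace_of_topology P) (pspace_of_topology Q)) (x, y)
        \<longleftrightarrow> F \<in> lims (pspace_of_topology (prod_topology P Q)) (x, y)" for F x y
  proof (cases "F \<noteq> bot \<and> F \<le> principal (topspace P \<times> topspace Q)
               \<and> x \<in> topspace P \<and> y \<in> topspace Q")
    case True
    then have F: "eventually (\<lambda>p. p \<in> topspace P \<times> topspace Q) F" "x \<in> topspace P" "y \<in> topspace Q"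
      by (auto simp: le_principal)
    have 1: "filtermap fst F \<le> nhdsin P x \<longleftrightarrow> limitin P fst x F"
      using F by (auto simp: limitin_def nhdsin_def le_INF_iff le_principal eventually_filtermap)
    have 2: "filtermap snd F \<le> nhdsin Q y \<longleftrightarrow> limitin Q snd y F"
      using F by (auto simp: limitin_def nhdsin_def le_INF_iff le_principal eventually_filtermap)
    have 3: "F \<le> nhdsin (prod_topology P Q) (x, y) \<longleftrightarrow> limitin (prod_topology P Q) id (x, y) F"
      using F by (auto simp: limitin_def nhdsin_def le_INF_iff le_principal)
    have "filtermap fst F \<le> principal (topspace P)" "filtermap snd F \<le> principal (topspace Q)"
      using F by (auto simp: le_principal eventually_filtermap elim: eventually_mono)
    then show ?thesis
      using True by (simp add: prod_pspace_def lims_pspace_of_topology filters_on_def 1 2 3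
          limitin_pairwise filtermap_bot_iff o_def)
  next
    \<comment> \<open>Neither side holds here: a convergent filter is proper and contains the space,
      and \<open>nhdsin\<close> is \<open>bot\<close> at points outside it.\<close>
    case False
    then show ?thesis
      by (auto simp: prod_pspace_def lims_pspace_of_topology filters_on_def filtermap_bot_iff bot_unique)
  qed
  then have "lims (prod_pspace (pspace_of_topology P) (pspace_of_topology Q))
      = lims (pspace_of_topology (prod_topology P Q))"
    by (intro ext) (auto simp: set_eq_iff)
  moreover have "points (prod_pspace (pspace_of_topology P) (pspace_of_topology Q))
      = points (pspace_of_topology (prod_topology P Q))"
    by (simp add: prod_pspace_def)
  ultimately show ?thesis
    by simp
qed

text \<open>The pasting lemma. A convergent filter is the \<open>sup\<close> of its traces on
  \<open>C\<close> and \<open>D\<close>; each proper trace converges within its closed set, and the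
  images are rejoined by the axiom that the intersection of two convergent filters
  converges.\<close>

lemma pcontinuous_closed_cover:
  assumes T: "pseudotopological_space T"
    and cl: "closedin P C" "closedin P D" and cover: "topspace P \<subseteq> C \<union> D"
    and C: "pcontinuous (pspace_of_topology (subtopology P C)) T h"
    and D: "pcontinuous (pspace_of_topology (subtopology P D)) T h"
  shows "pcontinuous (pspace_of_topology P) T h"
  unfolding pcontinuous_def
proof (intro conjI ballI)
  have "h ` (topspace P \<inter> C) \<subseteq> points T" "h ` (topspace P \<inter> D) \<subseteq> points T"
    using C D by (auto simp: pcontinuous_def)
  then show im: "h ` points (pspace_of_topology P) \<subseteq> points T"
    using cover unfolding points_pspace_of_topology by blast
  fix x F assume x: "x \<in> points (pspace_of_topology P)" and F: "F \<in> lims (pspace_of_topology P) x"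
  have restrict: "filtermap h (inf F (principal A)) \<in> lims T (h x)"
    if A: "closedin P A" "pcontinuous (pspace_of_topology (subtopology P A)) T h"
      and nb: "inf F (principal A) \<noteq> bot" for A
  proof -
    \<comment> \<open>A filter with a proper trace on a closed set cannot converge to a point
      outside that set.\<close>
    have xA: "x \<in> A"
    proof (rule ccontr)
      assume "x \<notin> A"
      then have "eventually (\<lambda>y. y \<notin> A) (nhdsin P x)"
        using x A by (auto simp: eventually_nhdsin intro!: exI[of _ "topspace P - A"])
      then have "eventually (\<lambda>y. y \<notin> A) F"
        using F filter_leD by (auto simp: lims_pspace_of_topology)
      then show False
        using nb by (simp add: trivial_limit_def eventually_inf_principal)
    qed
    have "inf F (principal A) \<le> nhdsin (subtopology P A) x"
    proof (rule filter_leI)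
      fix Q assume "eventually Q (nhdsin (subtopology P A) x)"
      then obtain U where "openin P U" "x \<in> U" "\<forall>y\<in>U \<inter> A. Q y"
        using x xA by (auto simp: eventually_nhdsin openin_subtopology)
      then have "eventually (\<lambda>y. y \<in> A \<longrightarrow> Q y) (nhdsin P x)"
        by (auto simp: eventually_nhdsin)
      then have "eventually (\<lambda>y. y \<in> A \<longrightarrow> Q y) F"
        using F filter_leD by (auto simp: lims_pspace_of_topology)
      then show "eventually Q (inf F (principal A))"
        by (simp add: eventually_inf_principal)
    qed
    moreover have "inf F (principal A) \<le> principal (topspace (subtopology P A))"
      using F by (auto simp: lims_pspace_of_topology le_principal eventually_inf_principal
          elim: eventually_mono)
    ultimately have "inf F (principal A) \<in> lims (pspace_of_topology (subtopology P A)) x"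
      using nb by (simp add: lims_pspace_of_topology)
    then show ?thesis
      using A(2) x xA by (auto simp: pcontinuous_def)
  qed
  have "F \<le> principal (C \<union> D)"
    using F cover by (auto simp: lims_pspace_of_topology le_principal elim: eventually_mono)
  then have split: "F = sup (inf F (principal C)) (inf F (principal D))"
    by (metis inf.absorb1 inf_sup_distrib1 sup_principal)
  \<comment> \<open>The axiom on \<open>sup\<close> needs two proper traces; if one is improper,
    \<open>F\<close> equals the other.\<close>
  consider "inf F (principal C) = bot" "inf F (principal D) = F"
    | "inf F (principal D) = bot" "inf F (principal C) = F"
    | "inf F (principal C) \<noteq> bot" "inf F (principal D) \<noteq> bot"
    using split by (metis sup_bot.left_neutral sup_bot.right_neutral)
  then show "filtermap h F \<in> lims T (h x)"
  proof cases
    case 1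
    then show ?thesis
      using restrict[OF cl(2) D] F by (auto simp: lims_pspace_of_topology)
  next
    case 2
    then show ?thesis
      using restrict[OF cl(1) C] F by (auto simp: lims_pspace_of_topology)
  next
    case 3
    have "h x \<in> points T"
      using im x by blast
    then show ?thesis
      using pseudotopologicalD(3)[OF T _ restrict[OF cl(1) C 3(1)] restrict[OF cl(2) D 3(2)]] split
      by (metis filtermap_sup)
  qed
qed

section \<open>Based homotopy\<close>

lemma based_homotopy_rel_iff:
  "(f, g) \<in> based_homotopy_rel (pspace_of_topology P) a T b \<longleftrightarrow>
     f \<in> based_maps (pspace_of_topology P) a T b \<and> g \<in> based_maps (pspace_of_topology P) a T b \<and>
     (\<exists>H. pcontinuous (pspace_of_topology (prod_topology P (top_of_set {0..1::real}))) T H \<and>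
          (\<forall>x\<in>topspace P. H (x, 0) = f x \<and> H (x, 1) = g x) \<and> (\<forall>t\<in>{0..1}. H (a, t) = b))"
  by (simp add: based_homotopy_rel_def prod_pspace_of_topology)

lemma equiv_based_homotopy_rel:
  assumes T: "pseudotopological_space T" and a: "a \<in> topspace P"
  shows "equiv (based_maps (pspace_of_topology P) a T b) (based_homotopy_rel (pspace_of_topology P) a T b)"
proof (rule equivI)
  let ?I = "top_of_set {0..1::real}"
  let ?R = "based_homotopy_rel (pspace_of_topology P) a T b"
  show "?R \<subseteq> based_maps (pspace_of_topology P) a T b \<times> based_maps (pspace_of_topology P) a T b"
    by (auto simp: based_homotopy_rel_def)
  show "refl_on (based_maps (pspace_of_topology P) a T b) ?R"
  proof (rule refl_onI)
    fix f assume f: "f \<in> based_maps (pspace_of_topology P) a T b"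
    then have "pcontinuous (pspace_of_topology (prod_topology P ?I)) T (f \<circ> fst)"
      by (intro pcontinuous_compose_continuous_map[OF continuous_map_fst])
         (simp add: based_maps_def)
    then show "(f, f) \<in> ?R"
      using f unfolding based_homotopy_rel_iff
      by (intro conjI exI[of _ "f \<circ> fst"]) (auto simp: based_maps_def)
  qed
  show "sym ?R"
  proof (rule symI)
    fix f g assume fg: "(f, g) \<in> ?R"
    then obtain H where H: "pcontinuous (pspace_of_topology (prod_topology P ?I)) T H"
      "\<forall>x\<in>topspace P. H (x, 0) = f x \<and> H (x, 1) = g x" "\<forall>t\<in>{0..1}. H (a, t) = b"
      unfolding based_homotopy_rel_iff by blast
    let ?r = "\<lambda>z. (fst z, 1 - snd z)"
    have I: "continuous_map (prod_topology P ?I) ?I (\<lambda>z. 1 - snd z)"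
    proof -
      have "continuous_map (prod_topology P ?I) ?I ((\<lambda>t. 1 - t) \<circ> snd)"
        by (rule continuous_map_compose[OF continuous_map_snd]) (auto intro!: continuous_intros)
      then show ?thesis
        by (simp add: o_def)
    qed
    have "continuous_map (prod_topology P ?I) (prod_topology P ?I) ?r"
      by (intro continuous_map_pairedI continuous_map_fst I)
    then have "pcontinuous (pspace_of_topology (prod_topology P ?I)) T (H \<circ> ?r)"
      using H(1) by (rule pcontinuous_compose_continuous_map)
    then show "(g, f) \<in> ?R"
      using fg H(2,3) unfolding based_homotopy_rel_iff by (intro conjI exI[of _ "H \<circ> ?r"]) auto
  qed
  show "trans ?R"
  proof (rule transI)
    fix f g h assume fg: "(f, g) \<in> ?R" and gh: "(g, h) \<in> ?R"
    obtain H where H: "pcontinuous (pspace_of_topology (prod_topology P ?I)) T H"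
      "\<forall>x\<in>topspace P. H (x, 0) = f x \<and> H (x, 1) = g x" "\<forall>t\<in>{0..1}. H (a, t) = b"
      using fg unfolding based_homotopy_rel_iff by blast
    obtain K where K: "pcontinuous (pspace_of_topology (prod_topology P ?I)) T K"
      "\<forall>x\<in>topspace P. K (x, 0) = g x \<and> K (x, 1) = h x" "\<forall>t\<in>{0..1}. K (a, t) = b"
      using gh unfolding based_homotopy_rel_iff by blast
    define L where "L z = (if snd z \<le> 1/2 then H (fst z, 2 * snd z) else K (fst z, 2 * snd z - 1))" for z
    let ?C = "topspace P \<times> {0..1/2::real}" and ?D = "topspace P \<times> {1/2..1::real}"
    let ?PI = "prod_topology P ?I"
    have cl: "closedin ?PI ?C" "closedin ?PI ?D"
      by (auto simp: closedin_prod_Times_iff intro!: closed_subset)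
    have sub: "subtopology ?PI ?C = prod_topology P (top_of_set {0..1/2})"
      "subtopology ?PI ?D = prod_topology P (top_of_set {1/2..1})"
      by (simp_all add: subtopology_Times subtopology_subtopology)
    have "continuous_map (prod_topology P (top_of_set {0..1/2})) ?I ((\<lambda>t. 2 * t) \<circ> snd)"
      by (rule continuous_map_compose[OF continuous_map_snd]) (auto intro!: continuous_intros)
    then have "continuous_map (prod_topology P (top_of_set {0..1/2})) ?PI (\<lambda>z. (fst z, 2 * snd z))"
      by (intro continuous_map_pairedI continuous_map_fst) (simp add: o_def)
    then have C: "pcontinuous (pspace_of_topology (subtopology ?PI ?C)) T L"
      using pcontinuous_compose_continuous_map[OF _ H(1)] unfolding sub
      by (subst pcontinuous_cong[where g = "H \<circ> (\<lambda>z. (fst z, 2 * snd z))"]) (auto simp: L_def)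
    have "continuous_map (prod_topology P (top_of_set {1/2..1})) ?I ((\<lambda>t. 2 * t - 1) \<circ> snd)"
      by (rule continuous_map_compose[OF continuous_map_snd]) (auto intro!: continuous_intros)
    then have *: "continuous_map (prod_topology P (top_of_set {1/2..1})) ?PI (\<lambda>z. (fst z, 2 * snd z - 1))"
      by (intro continuous_map_pairedI continuous_map_fst) (simp add: o_def)
    have D: "pcontinuous (pspace_of_topology (subtopology ?PI ?D)) T L"
    proof -
      \<comment> \<open>At time 1/2 the definition takes the branch of \<open>H\<close>; it agrees
        with that of \<open>K\<close> because both equal \<open>g\<close> there.\<close>
      have "L z = K (fst z, 2 * snd z - 1)" if "fst z \<in> topspace P" "snd z \<ge> 1/2" for z
        using that H(2) K(2) by (cases "2 * snd z = 1") (auto simp: L_def)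
      then show ?thesis
        using pcontinuous_compose_continuous_map[OF *(1) K(1)] unfolding sub
        by (subst pcontinuous_cong[where g = "K \<circ> (\<lambda>z. (fst z, 2 * snd z - 1))"]) auto
    qed
    have "pcontinuous (pspace_of_topology ?PI) T L"
      by (rule pcontinuous_closed_cover[OF T cl _ C D]) auto
    then show "(f, h) \<in> ?R"
      using fg gh H K unfolding based_homotopy_rel_iff
      by (intro conjI exI[of _ L]) (auto simp: L_def)
  qed
qed

lemma based_homotopy_rel_compose:
  assumes "pcontinuous T W \<phi>"
    and "(f, g) \<in> based_homotopy_rel (pspace_of_topology P) a T b"
  shows "(\<phi> \<circ> f, \<phi> \<circ> g) \<in> based_homotopy_rel (pspace_of_topology P) a W (\<phi> b)"
proof -
  obtain H where H: "pcontinuous (pspace_of_topology (prod_topology P (top_of_set {0..1::real}))) T H"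
      "\<forall>x\<in>topspace P. H (x, 0) = f x \<and> H (x, 1) = g x" "\<forall>t\<in>{0..1}. H (a, t) = b"
    using assms(2) unfolding based_homotopy_rel_iff by blast
  moreover have "f \<in> based_maps (pspace_of_topology P) a T b" "g \<in> based_maps (pspace_of_topology P) a T b"
    using assms(2) by (simp_all add: based_homotopy_rel_iff)
  ultimately show ?thesis
    using pcontinuous_compose[OF H(1) assms(1)] pcontinuous_compose[OF _ assms(1)] unfolding based_homotopy_rel_iff
    by (intro conjI exI[of _ "\<phi> \<circ> H"]) (auto simp: based_maps_def)
qed

section \<open>Multiplication of spheres\<close>

lemma continuous_map_sphere_pinch:
  assumes "n \<ge> 1"
  shows "continuous_map (nsphere n) (nsphere n) sphere_pinch"
proof -
  have "continuous_map (nsphere n) euclideanreal (\<lambda>x. sphere_pinch x k)" for k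
    unfolding sphere_pinch_def
    by (cases "k = 0"; cases "k = 1")
       (auto intro!: continuous_intros continuous_map_nsphere_projection)
  then have "continuous_map (nsphere n) (powertop_real UNIV) sphere_pinch"
    by (simp add: continuous_map_componentwise_UNIV)
  then have "continuous_map (nsphere n) (subtopology (powertop_real UNIV) (topspace (nsphere n))) sphere_pinch"
    using sphere_pinch_in_nsphere[OF assms] by (auto simp: continuous_map_in_subtopology)
  then show ?thesis
    by (simp add: nsphere)
qed

text \<open>The two homotopies are multiplied at each time. The halves agree on the equator, since
  the pinch map sends it to the base point, where both homotopies stay at \<open>b\<close>; so
  pasting applies. For constant homotopies this also gives continuity of products.\<close>

lemma sphere_mult_homotopy:
  assumes n: "n \<ge> 1" and T: "pseudotopological_space T"
    and f: "(f, f') \<in> based_homotopy_rel (sphere_pspace n) sphere_base T b"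
    and g: "(g, g') \<in> based_homotopy_rel (sphere_pspace n) sphere_base T b"
  shows "(sphere_mult f g, sphere_mult f' g') \<in> based_homotopy_rel (sphere_pspace n) sphere_base T b"
proof -
  let ?P = "nsphere n" and ?I = "top_of_set {0..1::real}"
  let ?PI = "prod_topology ?P ?I"
  obtain H where H: "pcontinuous (pspace_of_topology ?PI) T H"
      "\<forall>x\<in>topspace ?P. H (x, 0) = f x \<and> H (x, 1) = f' x" "\<forall>t\<in>{0..1}. H (sphere_base, t) = b"
    using f unfolding based_homotopy_rel_iff by blast
  obtain K where K: "pcontinuous (pspace_of_topology ?PI) T K"
      "\<forall>x\<in>topspace ?P. K (x, 0) = g x \<and> K (x, 1) = g' x" "\<forall>t\<in>{0..1}. K (sphere_base, t) = b"
    using g unfolding based_homotopy_rel_iff by blast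
  define L where "L z = sphere_mult (\<lambda>x. H (x, snd z)) (\<lambda>x. K (x, snd z)) (fst z)" for z
  let ?C = "{z \<in> topspace ?PI. 0 \<le> fst z 1}" and ?D = "{z \<in> topspace ?PI. fst z 1 \<le> 0}"
  have "continuous_map ?PI euclideanreal (\<lambda>z. fst z 1)"
    using continuous_map_compose[OF continuous_map_fst continuous_map_nsphere_projection]
    by (simp add: o_def)
  note cl = closedin_continuous_map_preimage[OF this]
  have "closedin ?PI {z \<in> topspace ?PI. fst z 1 \<in> {0..}}" "closedin ?PI {z \<in> topspace ?PI. fst z 1 \<in> {..0}}"
    by (rule cl; simp flip: closed_closedin)+
  then have cl: "closedin ?PI ?C" "closedin ?PI ?D"
    by simp_all
  let ?p = "\<lambda>z. (sphere_pinch (fst z), snd z)"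
  have "continuous_map ?PI ?PI ?p"
    using continuous_map_compose[OF continuous_map_fst continuous_map_sphere_pinch[OF n]]
    by (intro continuous_map_pairedI continuous_map_snd) (simp add: o_def)
  then have p: "continuous_map (subtopology ?PI A) ?PI ?p" for A
    by (rule continuous_map_from_subtopology)
  have C: "pcontinuous (pspace_of_topology (subtopology ?PI ?C)) T L"
    using pcontinuous_compose_continuous_map[OF p H(1), of ?C]
    by (subst pcontinuous_cong[where g = "H \<circ> ?p"]) (auto simp: L_def sphere_mult_def)
  have D: "pcontinuous (pspace_of_topology (subtopology ?PI ?D)) T L"
    using pcontinuous_compose_continuous_map[OF p K(1), of ?D] H(3) K(3)
    by (subst pcontinuous_cong[where g = "K \<circ> ?p"]) (auto simp: L_def sphere_mult_def sphere_pinch_equator)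
  have L: "pcontinuous (pspace_of_topology ?PI) T L"
    by (rule pcontinuous_closed_cover[OF T cl _ C D]) auto
  have base: "L (sphere_base, t) = b" if "t \<in> {0..1}" for t
    using that H(3) sphere_pinch_equator[of sphere_base]
    by (simp add: L_def sphere_mult_def) (simp add: sphere_base_def)
  have ends: "L (x, 0) = sphere_mult f g x" "L (x, 1) = sphere_mult f' g' x" if "x \<in> topspace ?P" for x
    using that H(2) K(2) sphere_pinch_in_nsphere[OF n that] by (auto simp: L_def sphere_mult_def)
  \<comment> \<open>The relation includes membership in the based maps; continuity of the two
    products is read off from \<open>L\<close> at times 0 and 1.\<close>
  have slice: "pcontinuous (sphere_pspace n) T (L \<circ> (\<lambda>x. (x, t)))" if "t \<in> {0..1}" for t
    using that by (intro pcontinuous_compose_continuous_map[OF _ L])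
      (auto intro: continuous_map_pairedI)
  have "pcontinuous (sphere_pspace n) T (sphere_mult f g)"
    using slice[of 0] by (subst pcontinuous_cong[where g = "L \<circ> (\<lambda>x. (x, 0))"]) (auto simp: ends)
  moreover have "pcontinuous (sphere_pspace n) T (sphere_mult f' g')"
    using slice[of 1] by (subst pcontinuous_cong[where g = "L \<circ> (\<lambda>x. (x, 1))"]) (auto simp: ends)
  ultimately show ?thesis
    using L base base[of 0] base[of 1] ends sphere_base_in_nsphere[of n]
    unfolding based_homotopy_rel_iff based_maps_def by (intro conjI exI[of _ L]) auto
qed

section \<open>Homotopy classes, products and induced maps through representatives\<close>

lemma homotopy_class_eq_iff:
  assumes "pseudotopological_space T" "f \<in> sphere_maps n T b" "g \<in> sphere_maps n T b"
  shows "homotopy_class n T b f = homotopy_class n T b g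
     \<longleftrightarrow> (f, g) \<in> based_homotopy_rel (sphere_pspace n) sphere_base T b"
  unfolding homotopy_class_def
  using eq_equiv_class_iff[OF equiv_based_homotopy_rel[OF assms(1) sphere_base_in_nsphere] assms(2,3)] .

lemma homotopy_setE:
  assumes "A \<in> homotopy_set n T b"
  obtains f where "f \<in> sphere_maps n T b" "A = homotopy_class n T b f"
  using assms unfolding homotopy_set_def homotopy_class_def by (rule quotientE)

lemma homotopy_class_in_homotopy_set:
  "f \<in> sphere_maps n T b \<Longrightarrow> homotopy_class n T b f \<in> homotopy_set n T b"
  unfolding homotopy_set_def homotopy_class_def by (rule quotientI)

lemma self_in_homotopy_class:
  assumes "pseudotopological_space T" "f \<in> sphere_maps n T b"
  shows "f \<in> homotopy_class n T b f"
  unfolding homotopy_class_def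
  using equiv_class_self[OF equiv_based_homotopy_rel[OF assms(1) sphere_base_in_nsphere] assms(2)] .

lemma sphere_mult_in_sphere_maps:
  assumes "n \<ge> 1" "pseudotopological_space T" "f \<in> sphere_maps n T b" "g \<in> sphere_maps n T b"
  shows "sphere_mult f g \<in> sphere_maps n T b"
proof -
  have "(f, f) \<in> based_homotopy_rel (sphere_pspace n) sphere_base T b"
    "(g, g) \<in> based_homotopy_rel (sphere_pspace n) sphere_base T b"
    using homotopy_class_eq_iff[OF assms(2)] assms(3,4) by blast+
  from sphere_mult_homotopy[OF assms(1,2) this] show ?thesis
    by (simp add: based_homotopy_rel_iff)
qed

text \<open>The union over representatives collapses: \<open>sphere_mult\<close> respects homotopy,
  so all members of the union are one class, and each factor contains its own
  representative.\<close>

lemma mult_homotopy_class: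
  assumes n: "n \<ge> 1" and T: "pseudotopological_space T"
    and f: "f \<in> sphere_maps n T b" and g: "g \<in> sphere_maps n T b"
  shows "homotopy_class n T b f \<otimes>\<^bsub>homotopy_group n T b\<^esub> homotopy_class n T b g
     = homotopy_class n T b (sphere_mult f g)"
proof -
  have eq: "homotopy_class n T b (sphere_mult f' g') = homotopy_class n T b (sphere_mult f g)"
    if "f' \<in> homotopy_class n T b f" "g' \<in> homotopy_class n T b g" for f' g'
  proof -
    have rel: "(f, f') \<in> based_homotopy_rel (sphere_pspace n) sphere_base T b"
      "(g, g') \<in> based_homotopy_rel (sphere_pspace n) sphere_base T b"
      using that by (simp_all add: homotopy_class_def)
    then have "f' \<in> sphere_maps n T b" "g' \<in> sphere_maps n T b"
      by (simp_all add: based_homotopy_rel_iff)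
    then show ?thesis
      using homotopy_class_eq_iff[OF T] sphere_mult_in_sphere_maps[OF n T] f g
        sphere_mult_homotopy[OF n T rel] by metis
  qed
  have "homotopy_class n T b f \<otimes>\<^bsub>homotopy_group n T b\<^esub> homotopy_class n T b g
      = (\<Union>f'\<in>homotopy_class n T b f. \<Union>g'\<in>homotopy_class n T b g. homotopy_class n T b (sphere_mult f g))"
    unfolding homotopy_group_def monoid.simps partial_object.simps by (intro SUP_cong refl eq)
  also have "\<dots> = homotopy_class n T b (sphere_mult f g)"
    using self_in_homotopy_class[OF T f] self_in_homotopy_class[OF T g] by blast
  finally show ?thesis .
qed

lemma homotopy_induced_class:
  assumes S: "pseudotopological_space S" and T: "pseudotopological_space T"
    and \<phi>: "pcontinuous S T \<phi>" and f: "f \<in> sphere_maps n S a"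
  shows "homotopy_induced n T a \<phi> (homotopy_class n S a f) = homotopy_class n T (\<phi> a) (\<phi> \<circ> f)"
proof -
  have eq: "homotopy_class n T (\<phi> a) (\<phi> \<circ> g) = homotopy_class n T (\<phi> a) (\<phi> \<circ> f)"
    if "g \<in> homotopy_class n S a f" for g
  proof -
    have "(f, g) \<in> based_homotopy_rel (sphere_pspace n) sphere_base S a"
      using that by (simp add: homotopy_class_def)
    from based_homotopy_rel_compose[OF \<phi> this] show ?thesis
      using homotopy_class_eq_iff[OF T] by (metis based_homotopy_rel_iff)
  qed
  have "homotopy_induced n T a \<phi> (homotopy_class n S a f)
      = (\<Union>g\<in>homotopy_class n S a f. homotopy_class n T (\<phi> a) (\<phi> \<circ> f))"
    unfolding homotopy_induced_def by (intro SUP_cong refl eq)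
  also have "\<dots> = homotopy_class n T (\<phi> a) (\<phi> \<circ> f)"
    using self_in_homotopy_class[OF S f] by blast
  finally show ?thesis .
qed

lemma compose_in_sphere_maps:
  "pcontinuous S T \<phi> \<Longrightarrow> f \<in> sphere_maps n S a \<Longrightarrow> \<phi> \<circ> f \<in> sphere_maps n T (\<phi> a)"
  by (auto simp: based_maps_def intro: pcontinuous_compose)

text \<open>Reduces weak equivalence to two statements about maps up to based homotopy.
  Multiplicativity comes for free, because composing with \<open>\<phi>\<close> after
  \<open>sphere_mult\<close> is the same as composing in each factor.\<close>

lemma weak_homotopy_equivalenceI:
  assumes S: "pseudotopological_space S" and T: "pseudotopological_space T"
    and \<phi>: "pcontinuous S T \<phi>"
    and surj: "\<And>n a g. a \<in> points S \<Longrightarrow> g \<in> sphere_maps n T (\<phi> a) \<Longrightarrow>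
      \<exists>f\<in>sphere_maps n S a. (g, \<phi> \<circ> f) \<in> based_homotopy_rel (sphere_pspace n) sphere_base T (\<phi> a)"
    and inj: "\<And>n a f g. a \<in> points S \<Longrightarrow> f \<in> sphere_maps n S a \<Longrightarrow> g \<in> sphere_maps n S a \<Longrightarrow>
      (\<phi> \<circ> f, \<phi> \<circ> g) \<in> based_homotopy_rel (sphere_pspace n) sphere_base T (\<phi> a) \<Longrightarrow>
      (f, g) \<in> based_homotopy_rel (sphere_pspace n) sphere_base S a"
  shows "weak_homotopy_equivalence S T \<phi>"
proof -
  note ind = homotopy_induced_class[OF S T \<phi>]
  have bij: "bij_betw (homotopy_induced n T a \<phi>) (homotopy_set n S a) (homotopy_set n T (\<phi> a))"
    if a: "a \<in> points S" for n a
    unfolding bij_betw_def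
  proof
    show "inj_on (homotopy_induced n T a \<phi>) (homotopy_set n S a)"
    proof (rule inj_onI)
      fix A B assume A: "A \<in> homotopy_set n S a" and B: "B \<in> homotopy_set n S a"
        and eq: "homotopy_induced n T a \<phi> A = homotopy_induced n T a \<phi> B"
      obtain f where f: "f \<in> sphere_maps n S a" "A = homotopy_class n S a f"
        using A by (rule homotopy_setE)
      obtain g where g: "g \<in> sphere_maps n S a" "B = homotopy_class n S a g"
        using B by (rule homotopy_setE)
      have "(\<phi> \<circ> f, \<phi> \<circ> g) \<in> based_homotopy_rel (sphere_pspace n) sphere_base T (\<phi> a)"
        using eq f g ind homotopy_class_eq_iff[OF T] compose_in_sphere_maps[OF \<phi>] by metis
      then show "A = B"
        using inj[OF a f(1) g(1)] homotopy_class_eq_iff[OF S f(1) g(1)] f g by blast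
    qed
    show "homotopy_induced n T a \<phi> ` homotopy_set n S a = homotopy_set n T (\<phi> a)"
    proof
      show "homotopy_induced n T a \<phi> ` homotopy_set n S a \<subseteq> homotopy_set n T (\<phi> a)"
      proof (rule image_subsetI)
        fix A assume "A \<in> homotopy_set n S a"
        then obtain f where f: "f \<in> sphere_maps n S a" "A = homotopy_class n S a f"
          by (rule homotopy_setE)
        show "homotopy_induced n T a \<phi> A \<in> homotopy_set n T (\<phi> a)"
          unfolding f(2) ind[OF f(1)]
          by (rule homotopy_class_in_homotopy_set[OF compose_in_sphere_maps[OF \<phi> f(1)]])
      qed
      show "homotopy_set n T (\<phi> a) \<subseteq> homotopy_induced n T a \<phi> ` homotopy_set n S a"
      proof
        fix B assume "B \<in> homotopy_set n T (\<phi> a)"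
        then obtain g where g: "g \<in> sphere_maps n T (\<phi> a)" "B = homotopy_class n T (\<phi> a) g"
          by (rule homotopy_setE)
        obtain f where f: "f \<in> sphere_maps n S a"
          "(g, \<phi> \<circ> f) \<in> based_homotopy_rel (sphere_pspace n) sphere_base T (\<phi> a)"
          using surj[OF a g(1)] by blast
        then have "B = homotopy_induced n T a \<phi> (homotopy_class n S a f)"
          using ind homotopy_class_eq_iff[OF T g(1)] compose_in_sphere_maps[OF \<phi> f(1)] g(2) by metis
        then show "B \<in> homotopy_induced n T a \<phi> ` homotopy_set n S a"
          using homotopy_class_in_homotopy_set[OF f(1)] by blast
      qed
    qed
  qed
  have "homotopy_induced n T a \<phi> \<in> iso (homotopy_group n S a) (homotopy_group n T (\<phi> a))"
    if a: "a \<in> points S" and n: "n \<ge> 1" for n a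
  proof -
    have carrT: "carrier (homotopy_group n T b) = homotopy_set n T b" for b
      by (simp add: homotopy_group_def)
    have carrS: "carrier (homotopy_group n S b) = homotopy_set n S b" for b
      by (simp add: homotopy_group_def)
    have "homotopy_induced n T a \<phi> (A \<otimes>\<^bsub>homotopy_group n S a\<^esub> B)
        = homotopy_induced n T a \<phi> A \<otimes>\<^bsub>homotopy_group n T (\<phi> a)\<^esub> homotopy_induced n T a \<phi> B"
      if A: "A \<in> homotopy_set n S a" and B: "B \<in> homotopy_set n S a" for A B
    proof -
      obtain f where f: "f \<in> sphere_maps n S a" "A = homotopy_class n S a f"
        using A by (rule homotopy_setE)
      obtain g where g: "g \<in> sphere_maps n S a" "B = homotopy_class n S a g"
        using B by (rule homotopy_setE)
      have "\<phi> \<circ> sphere_mult f g = sphere_mult (\<phi> \<circ> f) (\<phi> \<circ> g)"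
        by (auto simp: sphere_mult_def)
      then show ?thesis
        using f g ind sphere_mult_in_sphere_maps[OF n S f(1) g(1)] compose_in_sphere_maps[OF \<phi>]
        by (simp add: mult_homotopy_class[OF n S] mult_homotopy_class[OF n T])
    qed
    then show ?thesis
      using bij[OF a, of n] bij_betwE[OF bij[OF a, of n]]
      unfolding iso_def hom_def carrS carrT by auto
  qed
  then show ?thesis
    using \<phi> bij by (simp add: weak_homotopy_equivalence_def)
qed

section \<open>Maps into the realization of a clique complex\<close>

abbreviation support :: "('v \<Rightarrow> real) \<Rightarrow> 'v set" where
  "support t \<equiv> {v. 0 < t v}"

abbreviation clique_realization :: "'v set \<Rightarrow> ('v \<times> 'v) set \<Rightarrow> ('v \<Rightarrow> real) topology" where
  "clique_realization X E \<equiv> geometric_realization (clique_complex X E)"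

section \<open>Supports of points of the realization\<close>

lemma in_closed_simplex_support:
  assumes "t \<in> closed_simplex \<sigma>" "finite \<sigma>"
  shows "support t \<subseteq> \<sigma>" "support t \<noteq> {}" "sum t (support t) = 1" "t \<in> closed_simplex (support t)"
proof -
  show sub: "support t \<subseteq> \<sigma>"
    using assms(1) by (force simp: closed_simplex_def)
  have "sum t \<sigma> = sum t (support t)"
    using assms sub by (intro sum.mono_neutral_right) (auto simp: closed_simplex_def order_le_less)
  then show sum: "sum t (support t) = 1"
    using assms(1) by (simp add: closed_simplex_def)
  then show "support t \<noteq> {}"
    by force
  show "t \<in> closed_simplex (support t)"
    using assms(1) sum by (auto simp: closed_simplex_def order_le_less)
qed

text \<open>Nonempty subsets of cliques are cliques, so every point lies in the simplex spanned by
  its own support; this simplex then replaces an arbitrary one containing the point.\<close>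

lemma in_clique_realization_iff:
  "t \<in> topspace (clique_realization X E) \<longleftrightarrow> support t \<in> clique_complex X E \<and> t \<in> closed_simplex (support t)"
proof
  assume "t \<in> topspace (clique_realization X E)"
  then obtain \<sigma> where \<sigma>: "\<sigma> \<in> clique_complex X E" "t \<in> closed_simplex \<sigma>"
    by (auto simp: topspace_geometric_realization)
  then have "finite \<sigma>"
    by (simp add: clique_complex_def)
  note s = in_closed_simplex_support[OF \<sigma>(2) this]
  have "support t \<in> clique_complex X E"
    using \<sigma>(1) s(1,2) finite_subset[OF s(1)] unfolding clique_complex_def by blast
  then show "support t \<in> clique_complex X E \<and> t \<in> closed_simplex (support t)"
    using s(4) by simp
qed (auto simp: topspace_geometric_realization)

lemma finite_support: "t \<in> topspace (clique_realization X E) \<Longrightarrow> finite (support t)"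
  unfolding in_clique_realization_iff by (simp add: clique_complex_def)

lemma closed_simplex_in_clique_realization:
  "\<sigma> \<in> clique_complex X E \<Longrightarrow> t \<in> closed_simplex \<sigma> \<Longrightarrow> t \<in> topspace (clique_realization X E)"
  by (auto simp: topspace_geometric_realization)

lemma closed_simplex_mono:
  assumes "t \<in> closed_simplex \<sigma>" "\<sigma> \<subseteq> \<tau>" "finite \<tau>"
  shows "t \<in> closed_simplex \<tau>"
proof -
  have "sum t \<sigma> = sum t \<tau>"
    using assms by (intro sum.mono_neutral_left) (auto simp: closed_simplex_def)
  then show ?thesis
    using assms by (auto simp: closed_simplex_def)
qed

lemma closed_simplex_convex:
  assumes "t \<in> closed_simplex \<sigma>" "u \<in> closed_simplex \<sigma>" "0 \<le> l" "l \<le> 1"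
  shows "(\<lambda>v. (1 - l) * t v + l * u v) \<in> closed_simplex \<sigma>"
  using assms by (simp add: closed_simplex_def sum.distrib flip: sum_distrib_left)

text \<open>The weak topology is final for the inclusions of the closed simplices, so preimages of
  open sets can be tested on each simplex.\<close>

lemma continuous_map_from_realization:
  assumes "\<And>\<sigma>. \<sigma> \<in> K \<Longrightarrow> continuous_map (subtopology (powertop_real UNIV) (closed_simplex \<sigma>)) Y g"
  shows "continuous_map (geometric_realization K) Y g"
  unfolding continuous_map_def
proof (intro conjI allI impI)
  show "g \<in> topspace (geometric_realization K) \<rightarrow> topspace Y"
    using assms by (force simp: continuous_map_def topspace_geometric_realization)
  fix U assume U: "openin Y U"
  have "openin (subtopology (powertop_real UNIV) (closed_simplex \<sigma>))
      ({t \<in> topspace (geometric_realization K). g t \<in> U} \<inter> closed_simplex \<sigma>)" if \<sigma>: "\<sigma> \<in> K" for \<sigma>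
  proof -
    have "{t \<in> topspace (geometric_realization K). g t \<in> U} \<inter> closed_simplex \<sigma>
        = {t \<in> topspace (subtopology (powertop_real UNIV) (closed_simplex \<sigma>)). g t \<in> U}"
      using \<sigma> by (auto simp: topspace_geometric_realization)
    then show ?thesis
      using openin_continuous_map_preimage[OF assms[OF \<sigma>] U] by simp
  qed
  then show "openin (geometric_realization K) {t \<in> topspace (geometric_realization K). g t \<in> U}"
    by (auto simp: openin_geometric_realization topspace_geometric_realization)
qed

text \<open>The weights are arbitrary, possibly unbounded, since on one simplex only finitely many
  of them count. This freedom is what forces compact families to have finite support.\<close>

lemma continuous_map_weighted_sum:
  "continuous_map (clique_realization X E) euclideanreal (\<lambda>t. \<Sum>v\<in>support t. c v * t v)"
proof (rule continuous_map_from_realization)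
  fix \<sigma> assume "\<sigma> \<in> clique_complex X E"
  then have fin: "finite \<sigma>"
    by (simp add: clique_complex_def)
  have "(\<Sum>v\<in>support t. c v * t v) = (\<Sum>v\<in>\<sigma>. c v * t v)" if "t \<in> closed_simplex \<sigma>" for t
    using that in_closed_simplex_support(1)[OF that fin] fin
    by (intro sum.mono_neutral_left) (auto simp: closed_simplex_def order_le_less)
  moreover have "continuous_map (subtopology (powertop_real UNIV) (closed_simplex \<sigma>)) euclideanreal
      (\<lambda>t. \<Sum>v\<in>\<sigma>. c v * t v)"
    using fin by (intro continuous_map_sum continuous_intros continuous_map_from_subtopology
        continuous_map_product_projection) auto
  ultimately show "continuous_map (subtopology (powertop_real UNIV) (closed_simplex \<sigma>)) euclideanreal
      (\<lambda>t. \<Sum>v\<in>support t. c v * t v)"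
    by (subst continuous_map_eq) auto
qed

lemma continuous_map_coordinate:
  "continuous_map (clique_realization X E) euclideanreal (\<lambda>t. t v)"
  by (intro continuous_map_from_realization continuous_map_from_subtopology
      continuous_map_product_projection) auto

text \<open>The open star of a face: finitely many conditions \<open>0 < t v\<close> on continuous
  coordinates.\<close>

lemma openin_star:
  assumes "finite A"
  shows "openin (clique_realization X E) {t \<in> topspace (clique_realization X E). A \<subseteq> support t}"
proof -
  have "openin (clique_realization X E) {t \<in> topspace (clique_realization X E). t v \<in> {0<..}}" for v
    by (rule openin_continuous_map_preimage[OF continuous_map_coordinate]) (simp flip: open_openin)
  then have *: "openin (clique_realization X E) {t \<in> topspace (clique_realization X E). 0 < t v}" for v
    by simp
  show ?thesis
    using assms
  proof induction
    case (insert v A)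
    then have "openin (clique_realization X E)
      ({t \<in> topspace (clique_realization X E). 0 < t v} \<inter> {t \<in> topspace (clique_realization X E). A \<subseteq> support t})"
      using * by blast
    moreover have "{t \<in> topspace (clique_realization X E). 0 < t v} \<inter> {t \<in> topspace (clique_realization X E). A \<subseteq> support t}
        = {t \<in> topspace (clique_realization X E). insert v A \<subseteq> support t}"
      by auto
    ultimately show ?case
      by simp
  qed simp
qed

text \<open>On a compact set only finitely many coordinates vary: otherwise a weighted sum of the
  coordinates with suitable weights would be continuous but unbounded.\<close>

lemma finite_support_compact:
  assumes P: "compact_space P" and F: "continuous_map P (clique_realization X E) F"
  shows "finite (\<Union>s\<in>topspace P. support (F s))"
proof (rule ccontr)
  assume "infinite (\<Union>s\<in>topspace P. support (F s))"
  then obtain w :: "nat \<Rightarrow> 'b" where w: "inj w" "range w \<subseteq> (\<Union>s\<in>topspace P. support (F s))"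
    using infinite_countable_subset by blast
  have "\<forall>n. \<exists>s. s \<in> topspace P \<and> 0 < F s (w n)"
    using w(2) by fastforce
  then obtain s where s: "\<And>n. s n \<in> topspace P" "\<And>n. 0 < F (s n) (w n)"
    by metis
  \<comment> \<open>The weight at \<open>w n\<close> is \<open>n / F (s n) (w n)\<close>, well
    defined as \<open>w\<close> is injective. The term of \<open>w n\<close> alone then makes the
    weighted sum at \<open>F (s n)\<close> at least \<open>n\<close>.\<close>
  define c where "c v = (if v \<in> range w then real (inv_into UNIV w v) / F (s (inv_into UNIV w v)) v else 0)" for v
  have c0: "0 \<le> c v" for v
    using s(2) w(1) by (auto simp: c_def less_imp_le)
  define wsum where "wsum = (\<lambda>t. \<Sum>v\<in>support t. c v * t v)"
  have "continuous_map P euclideanreal (wsum \<circ> F)"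
    unfolding wsum_def by (rule continuous_map_compose[OF F continuous_map_weighted_sum])
  then have "compactin euclideanreal ((wsum \<circ> F) ` topspace P)"
    using P image_compactin compact_space_def by metis
  then have "bounded ((wsum \<circ> F) ` topspace P)"
    by (simp add: compact_imp_bounded)
  then obtain B where "\<And>x. x \<in> topspace P \<Longrightarrow> \<bar>wsum (F x)\<bar> \<le> B"
    unfolding bounded_iff by auto
  then have B: "wsum (F x) \<le> B" if "x \<in> topspace P" for x
    using that abs_le_D1 by blast
  obtain n where n: "real n > B"
    using reals_Archimedean2 by blast
  have "finite (support (F (s n)))"
    using continuous_map_image_subset_topspace[OF F] s(1) by (blast intro: finite_support)
  then have "c (w n) * F (s n) (w n) \<le> wsum (F (s n))"
    unfolding wsum_def using s(2) c0 by (intro member_le_sum) (auto simp: less_imp_le)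
  moreover have "c (w n) * F (s n) (w n) = real n"
    using w(1) s(2)[of n] by (simp add: c_def)
  ultimately show False
    using B[OF s(1), of n] n by simp
qed

section \<open>Maps with values in finitely many simplices\<close>

lemma closed_closed_simplex:
  assumes "finite \<sigma>"
  shows "closedin (powertop_real UNIV) (closed_simplex \<sigma>)"
proof -
  let ?P = "powertop_real UNIV"
  have pr: "continuous_map ?P euclideanreal (\<lambda>t. t v)" for v
    by (rule continuous_map_product_projection) simp
  have sm: "continuous_map ?P euclideanreal (\<lambda>t. sum t \<sigma>)"
    by (intro continuous_map_sum pr assms)
  have 1: "closedin ?P {t \<in> topspace ?P. t v \<in> {0..}}" for v
    by (rule closedin_continuous_map_preimage[OF pr]) (simp flip: closed_closedin)
  have 2: "closedin ?P {t \<in> topspace ?P. t v \<in> {0}}" for v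
    by (rule closedin_continuous_map_preimage[OF pr]) (simp flip: closed_closedin)
  have 3: "closedin ?P {t \<in> topspace ?P. sum t \<sigma> \<in> {1}}"
    by (rule closedin_continuous_map_preimage[OF sm]) (simp flip: closed_closedin)
  let ?A = "\<Inter>v. {t \<in> topspace ?P. t v \<in> {0..}}"
  let ?B = "\<Inter>v. {t \<in> topspace ?P. t v \<in> (if v \<in> \<sigma> then {0..} else {0})}"
  have B: "closedin ?P {t \<in> topspace ?P. t v \<in> (if v \<in> \<sigma> then {0..} else {0})}" for v
    using 1[of v] 2[of v] by (cases "v \<in> \<sigma>") auto
  have "closedin ?P ?A" "closedin ?P ?B"
    using 1 B by (auto intro!: closedin_Inter simp del: topspace_product_topology)
  then have "closedin ?P (?A \<inter> ?B \<inter> {t \<in> topspace ?P. sum t \<sigma> \<in> {1}})"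
    using 3 by blast
  moreover have "?A \<inter> ?B \<inter> {t \<in> topspace ?P. sum t \<sigma> \<in> {1}} = closed_simplex \<sigma>"
    by (auto simp: closed_simplex_def split: if_splits)
  ultimately show ?thesis
    by simp
qed

text \<open>Coordinatewise continuity suffices here because only finitely many cliques lie in
  \<open>W\<close>: the preimage of a closed set is the finite union of the preimages of its pieces
  in these simplices, and each piece is closed in the product topology.\<close>

lemma continuous_map_into_clique_realization:
  assumes F: "\<And>s. s \<in> topspace P \<Longrightarrow> F s \<in> topspace (clique_realization X E)"
    and W: "finite W" "\<And>s. s \<in> topspace P \<Longrightarrow> support (F s) \<subseteq> W"
    and cont: "\<And>v. continuous_map P euclideanreal (\<lambda>s. F s v)"
  shows "continuous_map P (clique_realization X E) F"
  unfolding continuous_map_closedin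
proof (intro conjI allI impI ballI)
  let ?R = "clique_realization X E"
  show "F \<in> topspace P \<rightarrow> topspace ?R"
    using F by blast
  fix C assume C: "closedin ?R C"
  have FP: "continuous_map P (powertop_real UNIV) F"
    using cont by (simp add: continuous_map_componentwise_UNIV)
  let ?S = "{\<sigma> \<in> clique_complex X E. \<sigma> \<subseteq> W}"
  have "closedin P {s \<in> topspace P. F s \<in> C \<inter> closed_simplex \<sigma>}" if \<sigma>: "\<sigma> \<in> clique_complex X E" for \<sigma>
  proof -
    have fin: "finite \<sigma>"
      using \<sigma> by (simp add: clique_complex_def)
    have sub: "C \<subseteq> topspace ?R" "closed_simplex \<sigma> \<subseteq> topspace ?R"
      using closedin_subset[OF C] \<sigma> by (auto simp: topspace_geometric_realization)
    have "openin ?R (topspace ?R - C)"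
      using C by blast
    then have op: "openin (subtopology (powertop_real UNIV) (closed_simplex \<sigma>)) ((topspace ?R - C) \<inter> closed_simplex \<sigma>)"
      using \<sigma> by (simp add: openin_geometric_realization)
    have "C \<inter> closed_simplex \<sigma> = topspace (subtopology (powertop_real UNIV) (closed_simplex \<sigma>))
        - (topspace ?R - C) \<inter> closed_simplex \<sigma>"
      using sub by auto
    then have "closedin (subtopology (powertop_real UNIV) (closed_simplex \<sigma>)) (C \<inter> closed_simplex \<sigma>)"
      using op by (metis closedin_diff closedin_topspace)
    then have "closedin (powertop_real UNIV) (C \<inter> closed_simplex \<sigma>)"
      by (rule closedin_trans_full) (rule closed_closed_simplex[OF fin])
    then show ?thesis
      by (rule closedin_continuous_map_preimage[OF FP])
  qed
  moreover have "finite ?S"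
    using W(1) by (intro finite_subset[of ?S "Pow W"]) auto
  ultimately have "closedin P (\<Union>\<sigma>\<in>?S. {s \<in> topspace P. F s \<in> C \<inter> closed_simplex \<sigma>})"
    by (intro closedin_Union) auto
  moreover have "(\<Union>\<sigma>\<in>?S. {s \<in> topspace P. F s \<in> C \<inter> closed_simplex \<sigma>}) = {s \<in> topspace P. F s \<in> C}"
    using F W(2) by (fastforce simp: in_clique_realization_iff)
  ultimately show "closedin P {s \<in> topspace P. F s \<in> C}"
    by simp
qed

section \<open>Continuous maps into a graph\<close>

text \<open>It suffices to test the neighborhood filter of \<open>x\<close>, the coarsest filter
  converging to \<open>x\<close>. As neighborhood filters of the graph are principal, one open set
  on which all values are neighbors of \<open>g x\<close> decides.\<close>

lemma pcontinuous_graph_iff: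
  assumes "reflexive_graph X E"
  shows "pcontinuous (pspace_of_topology P) (graph_pspace X E) g \<longleftrightarrow>
     g ` topspace P \<subseteq> X \<and> (\<forall>x\<in>topspace P. \<exists>U. openin P U \<and> x \<in> U \<and> (\<forall>y\<in>U. (g x, g y) \<in> E))"
    (is "?L \<longleftrightarrow> ?R")
proof
  have lims: "F \<in> lims (graph_pspace X E) x
      \<longleftrightarrow> F \<noteq> bot \<and> eventually (\<lambda>y. y \<in> X) F \<and> eventually (\<lambda>y. (x, y) \<in> E) F" for F x
    by (simp add: graph_pspace_def pretop_of_def filters_on_def graph_closure_def le_principal)
  have pts: "points (graph_pspace X E) = X"
    by (simp add: graph_pspace_def pretop_of_def)
  show ?R if L: ?L
  proof (intro conjI ballI)
    show "g ` topspace P \<subseteq> X"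
      using L by (simp add: pcontinuous_def pts)
    fix x assume x: "x \<in> topspace P"
    have "nhdsin P x \<in> lims (pspace_of_topology P) x"
      using nhdsin_bounds[OF x] by (auto simp: lims_pspace_of_topology bot_unique principal_eq_bot_iff)
    then have "filtermap g (nhdsin P x) \<in> lims (graph_pspace X E) (g x)"
      using L x by (simp add: pcontinuous_def)
    then have "eventually (\<lambda>y. (g x, g y) \<in> E) (nhdsin P x)"
      by (simp add: lims eventually_filtermap)
    then show "\<exists>U. openin P U \<and> x \<in> U \<and> (\<forall>y\<in>U. (g x, g y) \<in> E)"
      using x by (simp add: eventually_nhdsin)
  qed
  show ?L if R: ?R
    unfolding pcontinuous_def
  proof (intro conjI ballI)
    show "g ` points (pspace_of_topology P) \<subseteq> points (graph_pspace X E)"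
      using R by (simp add: pts)
    fix x F assume x: "x \<in> points (pspace_of_topology P)" and F: "F \<in> lims (pspace_of_topology P) x"
    have "eventually (\<lambda>y. (g x, g y) \<in> E) (nhdsin P x)"
      using R x by (auto simp: eventually_nhdsin)
    then have "eventually (\<lambda>y. (g x, g y) \<in> E) F"
      using F filter_leD by (auto simp: lims_pspace_of_topology)
    moreover have "eventually (\<lambda>y. g y \<in> X) F"
      using F R by (auto simp: lims_pspace_of_topology le_principal elim!: eventually_mono)
    ultimately show "filtermap g F \<in> lims (graph_pspace X E) (g x)"
      using F by (simp add: lims eventually_filtermap filtermap_bot_iff lims_pspace_of_topology)
  qed
qed

lemma pcontinuous_graph_metric_iff:
  fixes S :: "'a::metric_space set"
  assumes "reflexive_graph X E"
  shows "pcontinuous (pspace_of_topology (top_of_set S)) (graph_pspace X E) g \<longleftrightarrow>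
     g ` S \<subseteq> X \<and> (\<forall>x\<in>S. \<exists>e>0. \<forall>y\<in>S. dist x y < e \<longrightarrow> (g x, g y) \<in> E)"
proof -
  have "(\<exists>U. openin (top_of_set S) U \<and> x \<in> U \<and> (\<forall>y\<in>U. (g x, g y) \<in> E))
      \<longleftrightarrow> (\<exists>e>0. \<forall>y\<in>S. dist x y < e \<longrightarrow> (g x, g y) \<in> E)" if x: "x \<in> S" for x
  proof
    assume "\<exists>U. openin (top_of_set S) U \<and> x \<in> U \<and> (\<forall>y\<in>U. (g x, g y) \<in> E)"
    then show "\<exists>e>0. \<forall>y\<in>S. dist x y < e \<longrightarrow> (g x, g y) \<in> E"
      unfolding openin_euclidean_subtopology_iff by (metis dist_commute)
  next
    assume "\<exists>e>0. \<forall>y\<in>S. dist x y < e \<longrightarrow> (g x, g y) \<in> E"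
    then obtain e where "e > 0" "\<forall>y\<in>S. dist x y < e \<longrightarrow> (g x, g y) \<in> E"
      by blast
    then show "\<exists>U. openin (top_of_set S) U \<and> x \<in> U \<and> (\<forall>y\<in>U. (g x, g y) \<in> E)"
      using x by (intro exI[of _ "S \<inter> ball x e"]) auto
  qed
  then show ?thesis
    by (simp add: pcontinuous_graph_iff[OF assms])
qed

text \<open>The homotopy is \<open>g\<close> before time 1 and \<open>h\<close> at time 1. The
  hypothesis is needed in one direction only: near a point at time 1, the value \<open>h s\<close>
  must be adjacent to the values of \<open>g\<close>.\<close>

lemma close_maps_homotopic:
  fixes S :: "'a::metric_space set"
  assumes XE: "reflexive_graph X E"
    and g: "g \<in> based_maps (pspace_of_topology (top_of_set S)) a (graph_pspace X E) b"
    and h: "h \<in> based_maps (pspace_of_topology (top_of_set S)) a (graph_pspace X E) b"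
    and close: "\<And>s. s \<in> S \<Longrightarrow> \<exists>e>0. \<forall>s'\<in>S. dist s s' < e \<longrightarrow> (h s, g s') \<in> E"
  shows "(g, h) \<in> based_homotopy_rel (pspace_of_topology (top_of_set S)) a (graph_pspace X E) b"
proof -
  define H where "H z = (if snd z = (1::real) then h (fst z) else g (fst z))" for z
  note iff = pcontinuous_graph_metric_iff[OF XE]
  have gX: "g ` S \<subseteq> X" and gE: "\<And>s. s \<in> S \<Longrightarrow> \<exists>e>0. \<forall>s'\<in>S. dist s s' < e \<longrightarrow> (g s, g s') \<in> E"
    and hX: "h ` S \<subseteq> X" and hE: "\<And>s. s \<in> S \<Longrightarrow> \<exists>e>0. \<forall>s'\<in>S. dist s s' < e \<longrightarrow> (h s, h s') \<in> E"
    using g h by (simp_all add: based_maps_def iff)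
  have "pcontinuous (pspace_of_topology (top_of_set (S \<times> {0..1}))) (graph_pspace X E) H"
    unfolding iff
  proof (intro conjI ballI)
    show "H ` (S \<times> {0..1}) \<subseteq> X"
      using gX hX by (auto simp: H_def)
    fix z assume z: "z \<in> S \<times> {0..1::real}"
    obtain s t where st: "z = (s, t)" "s \<in> S"
      using z by auto
    have d: "dist s s' < e" "dist t t' < e" if "dist z (s', t') < e" for s' t' e
      using dist_fst_le[of z "(s', t')"] dist_snd_le[of z "(s', t')"] that st by auto
    show "\<exists>e>0. \<forall>y\<in>S \<times> {0..1}. dist z y < e \<longrightarrow> (H z, H y) \<in> E"
    proof (cases "t = 1")
      case True
      obtain e1 where e1: "e1 > 0" "\<forall>s'\<in>S. dist s s' < e1 \<longrightarrow> (h s, g s') \<in> E"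
        using close[OF st(2)] by blast
      obtain e2 where e2: "e2 > 0" "\<forall>s'\<in>S. dist s s' < e2 \<longrightarrow> (h s, h s') \<in> E"
        using hE[OF st(2)] by blast
      show ?thesis
        using e1 e2 d(1) True st by (intro exI[of _ "min e1 e2"]) (auto simp: H_def)
    next
      case False
      obtain e where e: "e > 0" "\<forall>s'\<in>S. dist s s' < e \<longrightarrow> (g s, g s') \<in> E"
        using gE[OF st(2)] by blast
      show ?thesis
      \<comment> \<open>The bound \<open>\<bar>t - 1\<bar>\<close> keeps the ball away from time 1,
        so only \<open>g\<close> occurs in it.\<close>
      proof (intro exI[of _ "min e \<bar>t - 1\<bar>"] conjI ballI impI)
        fix y assume y: "y \<in> S \<times> {0..1}" "dist z y < min e \<bar>t - 1\<bar>"
        then obtain s' t' where st': "y = (s', t')" "s' \<in> S"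
          by auto
        then have "dist s s' < e" "dist t t' < \<bar>t - 1\<bar>"
          using d[of s' t' "min e \<bar>t - 1\<bar>"] y by auto
        then show "(H z, H y) \<in> E"
          using e st st' False by (auto simp: H_def dist_real_def)
      qed (use e False in auto)
    qed
  qed
  then show ?thesis
    using g h unfolding based_homotopy_rel_iff prod_topology_subtopology_eu
    by (intro conjI exI[of _ H]) (auto simp: H_def based_maps_def)
qed

section \<open>The comparison map from the realization to the graph\<close>

definition vertex_choice :: "('v \<Rightarrow> real) \<Rightarrow> 'v" where
  "vertex_choice t = (SOME v. v \<in> support t)"

lemma vertex_choice_in_support:
  assumes "t \<in> topspace (clique_realization X E)"
  shows "vertex_choice t \<in> support t"
proof -
  have "support t \<noteq> {}"
    using assms[unfolded in_clique_realization_iff] by (simp add: clique_complex_def)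
  then show ?thesis
    unfolding vertex_choice_def some_in_eq .
qed

text \<open>Near \<open>t\<close> the support can only grow, so the vertices chosen for
  \<open>t\<close> and for a nearby \<open>u\<close> both lie in the clique
  \<open>support u\<close>, whatever the choice was.\<close>

lemma pcontinuous_vertex_choice:
  assumes "reflexive_graph X E"
  shows "pcontinuous (pspace_of_topology (clique_realization X E)) (graph_pspace X E) vertex_choice"
  unfolding pcontinuous_graph_iff[OF assms]
proof (intro conjI ballI)
  let ?R = "clique_realization X E"
  have cl: "support t \<in> clique_complex X E" if "t \<in> topspace ?R" for t
    using that by (simp add: in_clique_realization_iff)
  show "vertex_choice ` topspace ?R \<subseteq> X"
    using cl vertex_choice_in_support unfolding clique_complex_def by blast
  fix t assume t: "t \<in> topspace ?R"
  let ?U = "{u \<in> topspace ?R. support t \<subseteq> support u}"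
  have "(vertex_choice t, vertex_choice u) \<in> E" if "u \<in> ?U" for u
    using cl[of u] vertex_choice_in_support[OF t] vertex_choice_in_support[of u X E] that
    unfolding clique_complex_def by blast
  moreover have "openin ?R ?U"
    using cl[OF t] by (intro openin_star) (simp add: clique_complex_def)
  ultimately show "\<exists>U. openin ?R U \<and> t \<in> U \<and> (\<forall>u\<in>U. (vertex_choice t, vertex_choice u) \<in> E)"
    using t by blast
qed

section \<open>Approximation by maps into the realization\<close>

text \<open>The second property of \<open>K\<close> allows interpolation with \<open>F\<close>
  inside the simplices of \<open>F\<close>. The third is the hypothesis of
  \<open>close_maps_homotopic\<close> for any choice of a vertex in the support of
  \<open>K s\<close>.\<close>

lemma clique_approximation:
  fixes S N :: "'a::metric_space set" and F :: "'a \<Rightarrow> 'v \<Rightarrow> real"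
  assumes XE: "reflexive_graph X E" and S: "compact S" and N: "closed N" "N \<subseteq> S"
    and G: "pcontinuous (pspace_of_topology (top_of_set S)) (graph_pspace X E) G"
    and F: "continuous_map (top_of_set N) (clique_realization X E) F"
    and GF: "\<And>s. s \<in> N \<Longrightarrow> G s \<in> support (F s)"
  obtains K where "continuous_map (top_of_set S) (clique_realization X E) K"
    and "\<And>s. s \<in> N \<Longrightarrow> support (K s) \<subseteq> support (F s)"
    and "\<And>s. s \<in> S \<Longrightarrow> \<exists>e>0. \<forall>s'\<in>S. dist s s' < e \<longrightarrow> (\<forall>v\<in>support (K s). (v, G s') \<in> E)"
proof -
  let ?R = "clique_realization X E"
  have GX: "G s \<in> X" if "s \<in> S" for s
    using G that by (auto simp: pcontinuous_graph_metric_iff[OF XE])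
  have symE: "(y, x) \<in> E" if "(x, y) \<in> E" for x y
    using XE that by (auto simp: reflexive_graph_def sym_def)
  have "\<exists>r>0. (\<forall>s'\<in>S. dist s s' < 2 * r \<longrightarrow> (G s, G s') \<in> E) \<and>
      (\<forall>s'\<in>N. dist s s' < r \<longrightarrow> s \<in> N \<and> support (F s) \<subseteq> support (F s'))" if s: "s \<in> S" for s
  proof -
    obtain e where e: "e > 0" "\<forall>s'\<in>S. dist s s' < e \<longrightarrow> (G s, G s') \<in> E"
      using G s by (auto simp: pcontinuous_graph_metric_iff[OF XE])
    \<comment> \<open>For \<open>s\<close> in \<open>N\<close> the star of
      \<open>support (F s)\<close> is a neighborhood of \<open>F s\<close>; for \<open>s\<close>
      outside \<open>N\<close> a ball missing the closed set \<open>N\<close> makes the condition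
      vacuous.\<close>
    have "\<exists>d>0. \<forall>s'\<in>N. dist s s' < d \<longrightarrow> s \<in> N \<and> support (F s) \<subseteq> support (F s')"
    proof (cases "s \<in> N")
      case True
      have R: "F s \<in> topspace ?R" if "s \<in> N" for s
        using continuous_map_image_subset_topspace[OF F] that by auto
      then have "finite (support (F s))"
        using True finite_support by blast
      then have "openin (top_of_set N) {s' \<in> topspace (top_of_set N). F s' \<in> {t \<in> topspace ?R. support (F s) \<subseteq> support t}}"
        by (intro openin_continuous_map_preimage[OF F] openin_star)
      then obtain d where "d > 0" "\<forall>s'\<in>N. dist s' s < d \<longrightarrow> support (F s) \<subseteq> support (F s')"
        using True R unfolding openin_euclidean_subtopology_iff by auto
      then show ?thesis
        using True by (auto simp: dist_commute)
    next
      case False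
      then obtain d where "d > 0" "ball s d \<subseteq> - N"
        using N(1) openE[of "- N" s] by (auto simp: open_Compl)
      then show ?thesis
        by (intro exI[of _ d]) (auto simp: subset_iff)
    qed
    then obtain d where "d > 0" "\<forall>s'\<in>N. dist s s' < d \<longrightarrow> s \<in> N \<and> support (F s) \<subseteq> support (F s')"
      by blast
    with e show ?thesis
      by (intro exI[of _ "min (e / 2) d"]) auto
  qed
  then obtain r where r0: "\<And>s. s \<in> S \<Longrightarrow> r s > 0"
    and rG: "\<And>s s'. s \<in> S \<Longrightarrow> s' \<in> S \<Longrightarrow> dist s s' < 2 * r s \<Longrightarrow> (G s, G s') \<in> E"
    and rF: "\<And>s s'. s \<in> S \<Longrightarrow> s' \<in> N \<Longrightarrow> dist s s' < r s \<Longrightarrow> s \<in> N \<and> support (F s) \<subseteq> support (F s')"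
    by metis
  have "S \<subseteq> (\<Union>s\<in>S. ball s (r s))"
    using r0 by force
  then obtain I where I: "I \<subseteq> S" "finite I" "S \<subseteq> (\<Union>i\<in>I. ball i (r i))"
    by (rule compactE_image[OF S, rotated]) auto
  \<comment> \<open>A tent function, positive exactly on the ball around \<open>i\<close>.\<close>
  define \<phi> where "\<phi> i s = max 0 (r i - dist i s)" for i s
  define Z where "Z s = (\<Sum>i\<in>I. \<phi> i s)" for s
  \<comment> \<open>The weights are collected by vertex, since \<open>G\<close> may take the same
    value at several centers.\<close>
  define K where "K s v = (\<Sum>i\<in>{i\<in>I. G i = v}. \<phi> i s) / Z s" for s v
  define J where "J s = {i\<in>I. dist i s < r i}" for s
  have \<phi>0: "0 \<le> \<phi> i s" for i s
    by (simp add: \<phi>_def)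
  have \<phi>pos: "0 < \<phi> i s \<longleftrightarrow> dist i s < r i" for i s
    by (auto simp: \<phi>_def)
  have Z: "0 < Z s" if s: "s \<in> S" for s
  proof -
    obtain i where "i \<in> I" "dist i s < r i"
      using I(3) s by auto
    then show ?thesis
      unfolding Z_def using I(2) \<phi>0 \<phi>pos by (intro sum_pos2) auto
  qed
  have supp: "support (K s) = G ` J s" if s: "s \<in> S" for s
  proof -
    have "0 < K s v \<longleftrightarrow> (\<exists>i\<in>I. G i = v \<and> dist i s < r i)" for v
    proof -
      have "0 < K s v \<longleftrightarrow> 0 < (\<Sum>i\<in>{i\<in>I. G i = v}. \<phi> i s)"
        using Z[OF s] by (simp add: K_def zero_less_divide_iff)
      also have "\<dots> \<longleftrightarrow> (\<Sum>i\<in>{i\<in>I. G i = v}. \<phi> i s) \<noteq> 0"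
        using sum_nonneg[of "{i\<in>I. G i = v}" "\<lambda>i. \<phi> i s", OF \<phi>0] by linarith
      also have "\<dots> \<longleftrightarrow> (\<exists>i\<in>{i\<in>I. G i = v}. \<phi> i s \<noteq> 0)"
        using I(2) \<phi>0 by (subst sum_nonneg_eq_0_iff) auto
      also have "\<dots> \<longleftrightarrow> (\<exists>i\<in>I. G i = v \<and> dist i s < r i)"
        by (auto simp: \<phi>_def max_def)
      finally show ?thesis .
    qed
    then show ?thesis
      by (auto simp: J_def)
  qed
  have GJ: "(G i, G j) \<in> E" if "i \<in> J s" "j \<in> J s" for i j s
  proof -
    have "dist i j < r i + r j"
      using that dist_triangle2[of i j s] dist_commute[of s] by (auto simp: J_def)
    then have "dist i j < 2 * r i \<or> dist j i < 2 * r j"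
      by (auto simp: dist_commute)
    then show ?thesis
      using rG symE that I(1) unfolding J_def by blast
  qed
  have KR: "K s \<in> topspace ?R" if s: "s \<in> S" for s
  proof (rule closed_simplex_in_clique_realization)
    obtain i where "i \<in> I" "dist i s < r i"
      using I(3) s by auto
    then show "G ` J s \<in> clique_complex X E"
      using GX GJ I(1,2) by (fastforce simp: clique_complex_def J_def)
    have K0: "0 \<le> K s v" for v
      using Z[OF s] \<phi>0 by (simp add: K_def sum_nonneg)
    have "sum (K s) (G ` J s) = sum (K s) (G ` I)"
      using I(2) K0 supp[OF s] by (intro sum.mono_neutral_left) (auto simp: J_def order_le_less)
    also have "\<dots> = (\<Sum>v\<in>G ` I. \<Sum>i\<in>{i\<in>I. G i = v}. \<phi> i s) / Z s"
      by (simp add: K_def sum_divide_distrib)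
    also have "(\<Sum>v\<in>G ` I. \<Sum>i\<in>{i\<in>I. G i = v}. \<phi> i s) = Z s"
      unfolding Z_def using sum.image_gen[OF I(2)] by metis
    finally have "sum (K s) (G ` J s) = 1"
      using Z[OF s] by simp
    then show "K s \<in> closed_simplex (G ` J s)"
      using K0 supp[OF s] unfolding closed_simplex_def by (force simp: order_le_less)
  qed
  have Kc: "continuous_map (top_of_set S) ?R K"
  proof (rule continuous_map_into_clique_realization)
    show "finite (G ` I)"
      using I(2) by simp
    show "support (K s) \<subseteq> G ` I" if "s \<in> topspace (top_of_set S)" for s
      using that supp[of s] by (auto simp: J_def)
    fix v
    have "continuous_on S (\<lambda>s. K s v)"
      unfolding K_def Z_def \<phi>_def
      using Z unfolding Z_def \<phi>_def by (intro continuous_intros) force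
    then show "continuous_map (top_of_set S) euclideanreal (\<lambda>s. K s v)"
      by simp
  qed (use KR in simp)
  show thesis
  proof (rule that[OF Kc])
    show "support (K s) \<subseteq> support (F s)" if s: "s \<in> N" for s
    proof -
      \<comment> \<open>A center \<open>i\<close> whose ball contains a point \<open>s\<close> of
        \<open>N\<close> lies in \<open>N\<close> itself, so \<open>G i\<close> is in
        \<open>support (F i)\<close>, which is contained in \<open>support (F s)\<close>.\<close>
      have "G i \<in> support (F s)" if i: "i \<in> J s" for i
        using rF[of i s] GF[of i] s i I(1) by (auto simp: J_def)
      moreover have "s \<in> S"
        using s N(2) by blast
      ultimately show ?thesis
        unfolding supp[OF \<open>s \<in> S\<close>] by blast
    qed
    show "\<exists>e>0. \<forall>s'\<in>S. dist s s' < e \<longrightarrow> (\<forall>v\<in>support (K s). (v, G s') \<in> E)" if s: "s \<in> S" for s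
    \<comment> \<open>This radius keeps \<open>s'\<close> inside every chosen ball that contains
      \<open>s\<close>; the \<open>1\<close> makes the set visibly nonempty.\<close>
    proof (intro exI[of _ "Min (insert 1 ((\<lambda>i. r i - dist i s) ` J s))"] conjI ballI impI)
      have fin: "finite (J s)"
        using I(2) by (simp add: J_def)
      then show "0 < Min (insert 1 ((\<lambda>i. r i - dist i s) ` J s))"
        by (subst Min_gr_iff) (auto simp: J_def)
      fix s' v assume s': "s' \<in> S" "dist s s' < Min (insert 1 ((\<lambda>i. r i - dist i s) ` J s))"
        and v: "v \<in> support (K s)"
      obtain i where i: "i \<in> J s" "v = G i"
        using v supp[OF s] by auto
      have "dist s s' < r i - dist i s"
        using s'(2) fin i(1) by (subst (asm) Min_gr_iff) auto
      then have "dist i s' < r i"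
        using dist_triangle[of i s' s] by simp
      then have "dist i s' < 2 * r i"
        using zero_le_dist[of i s'] by linarith
      then show "(v, G s') \<in> E"
        using rG[of i s'] s'(1) i I(1) by (auto simp: J_def)
    qed
  qed
qed

text \<open>Interpolates between the approximation (\<open>l = 0\<close>) and \<open>F\<close>
  (\<open>l = 1\<close>). Over \<open>N\<close> this stays in the simplex spanned by the support of
  \<open>F s\<close>, and \<open>M\<close>, where \<open>l\<close> vanishes, covers the rest.
  Closeness to \<open>G\<close> is asserted where \<open>l s = 0\<close>; elsewhere the inclusion of
  supports takes its place.\<close>

lemma clique_approximation_extension:
  fixes S N M :: "'a::metric_space set" and F :: "'a \<Rightarrow> 'v \<Rightarrow> real"
  assumes XE: "reflexive_graph X E" and S: "compact S" "S = N \<union> M" and N: "closed N" and M: "closed M"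
    and G: "pcontinuous (pspace_of_topology (top_of_set S)) (graph_pspace X E) G"
    and F: "continuous_map (top_of_set N) (clique_realization X E) F"
    and GF: "\<And>s. s \<in> N \<Longrightarrow> G s \<in> support (F s)"
    and lam: "continuous_on S l" "\<And>s. s \<in> S \<Longrightarrow> 0 \<le> l s \<and> l s \<le> 1" "\<And>s. s \<in> M \<Longrightarrow> l s = (0::real)"
  obtains K where "continuous_map (top_of_set S) (clique_realization X E) K"
    and "\<And>s. s \<in> S \<Longrightarrow> l s = 1 \<Longrightarrow> K s = F s"
    and "\<And>s. s \<in> S \<Longrightarrow> l s \<noteq> 0 \<Longrightarrow> support (K s) \<subseteq> support (F s)"
    and "\<And>s. s \<in> S \<Longrightarrow> l s = 0 \<Longrightarrow>
      \<exists>e>0. \<forall>s'\<in>S. dist s s' < e \<longrightarrow> (\<forall>v\<in>support (K s). (v, G s') \<in> E)"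
proof -
  let ?R = "clique_realization X E"
  have "N \<subseteq> S"
    using S by blast
  obtain K where K: "continuous_map (top_of_set S) ?R K"
    "\<And>s. s \<in> N \<Longrightarrow> support (K s) \<subseteq> support (F s)"
    "\<And>s. s \<in> S \<Longrightarrow> \<exists>e>0. \<forall>s'\<in>S. dist s s' < e \<longrightarrow> (\<forall>v\<in>support (K s). (v, G s') \<in> E)"
    using clique_approximation[OF XE S(1) N \<open>N \<subseteq> S\<close> G F GF] by blast
  \<comment> \<open>Outside \<open>N\<close> nothing is known about \<open>F\<close>, but there
    \<open>l\<close> vanishes, so the default 0 is the right value of the second term.\<close>
  define L where "L s v = (1 - l s) * K s v + (if s \<in> N then l s * F s v else 0)" for s v
  have lN: "s \<in> N" if "s \<in> S" "l s \<noteq> 0" for s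
    using that lam(3) S(2) by blast
  have L0: "L s = K s" if "l s = 0" for s
    using that by (auto simp: L_def)
  have FR: "F s \<in> closed_simplex (support (F s))" "support (F s) \<in> clique_complex X E" if "s \<in> N" for s
    using continuous_map_image_subset_topspace[OF F] that by (auto simp: in_clique_realization_iff)
  have KR: "K s \<in> closed_simplex (support (K s))" "K s \<in> topspace ?R" if "s \<in> S" for s
    using continuous_map_image_subset_topspace[OF K(1)] that by (auto simp: in_clique_realization_iff)
  have LN: "L s \<in> closed_simplex (support (F s))" if s: "s \<in> N" for s
  proof -
    have "finite (support (F s))"
      using FR(2)[OF s] by (simp add: clique_complex_def)
    then have "K s \<in> closed_simplex (support (F s))"
      using closed_simplex_mono KR(1) K(2)[OF s] s \<open>N \<subseteq> S\<close> by blast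
    then have "(\<lambda>v. (1 - l s) * K s v + l s * F s v) \<in> closed_simplex (support (F s))"
      using FR(1)[OF s] lam(2) s \<open>N \<subseteq> S\<close> by (intro closed_simplex_convex) auto
    then show ?thesis
      using s by (simp add: L_def[abs_def])
  qed
  have LR: "L s \<in> topspace ?R" if s: "s \<in> S" for s
    using closed_simplex_in_clique_realization[OF FR(2) LN] L0[of s] KR(2)[OF s] lN[OF s] by metis
  have suppL: "support (L s) \<subseteq> support (F s)" if "s \<in> N" for s
    using in_closed_simplex_support(1)[OF LN[OF that]] FR(2)[OF that] by (simp add: clique_complex_def)
  \<comment> \<open>Compactness of \<open>N\<close> and \<open>S\<close> confines all supports to a
    finite set, so continuity of \<open>L\<close> can be checked on coordinates.\<close>
  have "compact N"
    using S(1) N \<open>N \<subseteq> S\<close> compact_Int_closed[of S N] by (simp add: Int_absorb1)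
  then have finF: "finite (\<Union>s\<in>N. support (F s))"
    using finite_support_compact[OF _ F] by (simp add: compact_space_subtopology)
  have finK: "finite (\<Union>s\<in>S. support (K s))"
    using finite_support_compact[OF _ K(1)] S(1) by (simp add: compact_space_subtopology)
  have Lc: "continuous_map (top_of_set S) ?R L"
  proof (rule continuous_map_into_clique_realization)
    show "finite ((\<Union>s\<in>N. support (F s)) \<union> (\<Union>s\<in>S. support (K s)))"
      using finF finK by simp
    fix s assume "s \<in> topspace (top_of_set S)"
    then have s: "s \<in> S"
      by simp
    show "L s \<in> topspace ?R"
      by (rule LR[OF s])
    show "support (L s) \<subseteq> (\<Union>s\<in>N. support (F s)) \<union> (\<Union>s\<in>S. support (K s))"
    proof (cases "s \<in> N")
      case True
      then show ?thesis
        using suppL by blast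
    next
      case False
      then have "L s = K s"
        using L0 lN[OF s] by blast
      then show ?thesis
        using s by auto
    qed
  next
    fix v
    have Kv: "continuous_on S (\<lambda>s. K s v)" and Fv: "continuous_on N (\<lambda>s. F s v)"
      using continuous_map_compose[OF K(1) continuous_map_coordinate, of v]
        continuous_map_compose[OF F continuous_map_coordinate, of v] by (simp_all add: o_def)
    have "continuous_on N (\<lambda>s. l s * F s v)"
      using Fv continuous_on_subset[OF lam(1) \<open>N \<subseteq> S\<close>] by (rule continuous_on_mult[rotated])
    \<comment> \<open>Both branches vanish on the overlap of \<open>N\<close> and
      \<open>M\<close>.\<close>
    then have "continuous_on (N \<union> M) (\<lambda>s. if s \<in> N then l s * F s v else 0)"
      using N M lam(3) by (intro continuous_on_cases) auto
    then have "continuous_on S (\<lambda>s. L s v)"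
      unfolding L_def S(2)[symmetric] using Kv lam(1) by (intro continuous_intros)
    then show "continuous_map (top_of_set S) euclideanreal (\<lambda>s. L s v)"
      by simp
  qed
  show thesis
  proof (rule that[OF Lc])
    show "L s = F s" if "s \<in> S" "l s = 1" for s
      using lN[OF that(1)] that(2) by (auto simp: L_def)
    show "support (L s) \<subseteq> support (F s)" if "s \<in> S" "l s \<noteq> 0" for s
      using suppL lN[OF that] by blast
    show "\<exists>e>0. \<forall>s'\<in>S. dist s s' < e \<longrightarrow> (\<forall>v\<in>support (L s). (v, G s') \<in> E)" if "s \<in> S" "l s = 0" for s
      using K(3)[OF that(1)] L0[OF that(2)] by simp
  qed
qed

section \<open>Lifting along the choice of a vertex\<close>

text \<open>Surjectivity on homotopy classes. An approximation of \<open>g\<close> need not take the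
  value \<open>x\<close> at the base point. So \<open>g\<close> is first made constant near
  \<open>a\<close>; there the constant map \<open>x\<close> serves as \<open>F\<close> in
  \<open>clique_approximation_extension\<close>, with \<open>l a = 1\<close>.\<close>

lemma vertex_choice_lift:
  fixes S :: "'a::metric_space set" and X :: "'v set"
  assumes XE: "reflexive_graph X E" and S: "compact S" and a: "a \<in> S"
    and x: "x \<in> topspace (clique_realization X E)"
    and g: "g \<in> based_maps (pspace_of_topology (top_of_set S)) a (graph_pspace X E) (vertex_choice x)"
  obtains k where
    "k \<in> based_maps (pspace_of_topology (top_of_set S)) a (pspace_of_topology (clique_realization X E)) x"
    "(g, vertex_choice \<circ> k)
       \<in> based_homotopy_rel (pspace_of_topology (top_of_set S)) a (graph_pspace X E) (vertex_choice x)"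
proof -
  let ?R = "clique_realization X E" and ?T = "graph_pspace X E" and ?S = "pspace_of_topology (top_of_set S)"
  let ?b = "vertex_choice x"
  note iff = pcontinuous_graph_metric_iff[OF XE]
  have bx: "?b \<in> support x"
    by (rule vertex_choice_in_support[OF x])
  have xE: "(u, v) \<in> E" "u \<in> X" if "u \<in> support x" "v \<in> support x" for u v
    using x that unfolding in_clique_realization_iff by (auto simp: clique_complex_def)
  have gX: "g ` S \<subseteq> X" and gE: "\<And>s. s \<in> S \<Longrightarrow> \<exists>e>0. \<forall>s'\<in>S. dist s s' < e \<longrightarrow> (g s, g s') \<in> E"
    and ga: "g a = ?b"
    using g by (simp_all add: based_maps_def iff)
  obtain d where d: "d > 0" "\<forall>s\<in>S. dist a s < 2 * d \<longrightarrow> (?b, g s) \<in> E"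
  proof -
    obtain e where "e > 0" "\<forall>s\<in>S. dist a s < e \<longrightarrow> (?b, g s) \<in> E"
      using gE[OF a] ga by auto
    then show thesis
      by (intro that[of "e / 2"]) auto
  qed
  define g' where "g' s = (if dist a s \<le> d then ?b else g s)" for s
  have near: "(?b, g s') \<in> E \<and> (?b, g' s') \<in> E" if "dist a s \<le> d" "s' \<in> S" "dist s s' < d" for s s'
  proof -
    have "dist a s' < 2 * d"
      using that dist_triangle[of a s' s] by simp
    then show ?thesis
      using d(2) that(2) xE(1)[OF bx bx] by (auto simp: g'_def)
  qed
  have far: "\<exists>e>0. \<forall>s'\<in>S. dist s s' < e \<longrightarrow> (g' s, g s') \<in> E \<and> (g' s, g' s') \<in> E" if s: "s \<in> S" for s
  proof (cases "dist a s \<le> d")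
    case True
    then show ?thesis
      using near d(1) by (intro exI[of _ d]) (auto simp: g'_def[of s])
  next
    case False
    obtain e where e: "e > 0" "\<forall>s'\<in>S. dist s s' < e \<longrightarrow> (g s, g s') \<in> E"
      using gE[OF s] by blast
    show ?thesis
    \<comment> \<open>The second bound keeps \<open>s'\<close> outside the closed ball, where
      \<open>g'\<close> is \<open>g\<close>.\<close>
    proof (intro exI[of _ "min e (dist a s - d)"] conjI ballI impI)
      fix s' assume s': "s' \<in> S" "dist s s' < min e (dist a s - d)"
      then have "d < dist a s'"
        using dist_triangle2[of a s s'] by simp
      then show "(g' s, g s') \<in> E" "(g' s, g' s') \<in> E"
        using s' e False by (auto simp: g'_def)
    qed (use e False in auto)
  qed
  have "?b \<in> X"
    using xE(2)[OF bx bx] .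
  then have g'c: "pcontinuous ?S ?T g'"
    unfolding iff
  proof (intro conjI ballI)
    show "g' ` S \<subseteq> X"
      using gX \<open>?b \<in> X\<close> by (auto simp: g'_def)
  qed (use far in meson)
  then have g': "g' \<in> based_maps ?S a ?T ?b"
    using d(1) by (simp add: based_maps_def g'_def)
  have gg': "(g, g') \<in> based_homotopy_rel ?S a ?T ?b"
    by (rule close_maps_homotopic[OF XE g g']) (use far in meson)
  \<comment> \<open>Equal to 1 at \<open>a\<close> and 0 from distance \<open>d / 2\<close> on,
    strictly inside the ball where \<open>g'\<close> is constant.\<close>
  define l where "l s = max 0 (1 - 2 * dist a s / d)" for s
  let ?N = "S \<inter> cball a d" and ?M = "{s \<in> S. d / 2 \<le> dist a s}"
  have "closed S"
    using S by (rule compact_imp_closed)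
  moreover have "closed {s. d / 2 \<le> dist a s}"
    by (intro closed_Collect_le continuous_intros)
  ultimately have cl: "closed ?N" "closed ?M"
    by (simp_all only: Collect_conj_eq Collect_mem_eq closed_Int closed_cball)
  have SNM: "S = ?N \<union> ?M"
    using d(1) by auto
  have xc: "continuous_map (top_of_set ?N) ?R (\<lambda>_. x)"
    using x by simp
  have g'x: "g' s \<in> support x" if "s \<in> ?N" for s
    using that bx by (simp add: g'_def)
  have lc: "continuous_on S l"
    unfolding l_def using d(1) by (intro continuous_intros) auto
  have l01: "0 \<le> l s \<and> l s \<le> 1" for s
    using d(1) by (simp add: l_def)
  have l0: "l s = 0 \<longleftrightarrow> d / 2 \<le> dist a s" for s
    using d(1) by (auto simp: l_def max_def field_simps)
  then have lM: "l s = 0" if "s \<in> ?M" for s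
    using that by simp
  obtain k where k: "continuous_map (top_of_set S) ?R k"
    "\<And>s. s \<in> S \<Longrightarrow> l s = 1 \<Longrightarrow> k s = x"
    "\<And>s. s \<in> S \<Longrightarrow> l s \<noteq> 0 \<Longrightarrow> support (k s) \<subseteq> support x"
    "\<And>s. s \<in> S \<Longrightarrow> l s = 0 \<Longrightarrow> \<exists>e>0. \<forall>s'\<in>S. dist s s' < e \<longrightarrow> (\<forall>v\<in>support (k s). (v, g' s') \<in> E)"
    by (rule clique_approximation_extension[OF XE S SNM cl g'c xc g'x lc l01 lM]) blast+
  have "k a = x"
    using k(2)[OF a] by (simp add: l_def)
  then have kb: "k \<in> based_maps ?S a (pspace_of_topology ?R) x"
    using k(1) by (simp add: based_maps_def pcontinuous_pspace_of_topology_iff)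
  have kS: "vertex_choice (k s) \<in> support (k s)" if "s \<in> S" for s
    using continuous_map_image_subset_topspace[OF k(1)] that by (intro vertex_choice_in_support) auto
  have "vertex_choice \<circ> k \<in> based_maps ?S a ?T ?b"
    using kb pcontinuous_compose[OF _ pcontinuous_vertex_choice[OF XE]] by (auto simp: based_maps_def)
  then have "(g', vertex_choice \<circ> k) \<in> based_homotopy_rel ?S a ?T ?b"
  proof (rule close_maps_homotopic[OF XE g'])
    fix s assume s: "s \<in> S"
    show "\<exists>e>0. \<forall>s'\<in>S. dist s s' < e \<longrightarrow> ((vertex_choice \<circ> k) s, g' s') \<in> E"
    proof (cases "l s = 0")
      case True
      then show ?thesis
        using k(4)[OF s True] kS[OF s] unfolding o_def by meson
    next
      case False
      \<comment> \<open>Here \<open>s\<close> is closer than \<open>d / 2\<close> to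
        \<open>a\<close>: the vertex chosen for \<open>k s\<close> lies in the clique
        \<open>support x\<close>, together with the constant value of \<open>g'\<close> near
        \<open>s\<close>.\<close>
      then have "vertex_choice (k s) \<in> support x"
        using k(3)[OF s] kS[OF s] by blast
      then have "((vertex_choice \<circ> k) s, ?b) \<in> E"
        using xE(1) bx by simp
      moreover have "g' s' = ?b" if "dist s s' < d / 2" for s'
        using that dist_triangle[of a s' s] False by (simp add: g'_def l0)
      ultimately show ?thesis
        using d(1) by (intro exI[of _ "d / 2"]) auto
    qed
  qed
  moreover have "equiv (based_maps ?S a ?T ?b) (based_homotopy_rel ?S a ?T ?b)"
    using a pretopological_graph_pspace[OF XE]
    by (intro equiv_based_homotopy_rel) (auto simp: pretopological_space_def)
  ultimately have "(g, vertex_choice \<circ> k) \<in> based_homotopy_rel ?S a ?T ?b"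
    using gg' by (meson equiv_def transD)
  with kb show thesis
    by (rule that)
qed

text \<open>Injectivity on homotopy classes. The homotopy \<open>H\<close> of the images is
  approximated by a map pinned to \<open>f\<close> and \<open>g\<close> at the ends and to
  \<open>x\<close> over the base point. To this end \<open>H\<close> is made to rest near both ends,
  and made constant near \<open>a\<close> in the middle third of the time, so that it selects a
  vertex in the support of a map \<open>F\<close> given near these three parts.\<close>

lemma vertex_choice_reflects_homotopy:
  fixes S :: "'a::metric_space set" and X :: "'v set"
  assumes XE: "reflexive_graph X E" and S: "compact S" and a: "a \<in> S"
    and f: "f \<in> based_maps (pspace_of_topology (top_of_set S)) a (pspace_of_topology (clique_realization X E)) x"
    and g: "g \<in> based_maps (pspace_of_topology (top_of_set S)) a (pspace_of_topology (clique_realization X E)) x"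
    and rel: "(vertex_choice \<circ> f, vertex_choice \<circ> g)
       \<in> based_homotopy_rel (pspace_of_topology (top_of_set S)) a (graph_pspace X E) (vertex_choice x)"
  shows "(f, g) \<in> based_homotopy_rel (pspace_of_topology (top_of_set S)) a
      (pspace_of_topology (clique_realization X E)) x"
proof -
  let ?R = "clique_realization X E" and ?b = "vertex_choice x" and ?I = "{0..1::real}"
  let ?SI = "S \<times> ?I"
  note iff = pcontinuous_graph_metric_iff[OF XE]
  have fc: "continuous_map (top_of_set S) ?R f" and fa: "f a = x"
    and gc: "continuous_map (top_of_set S) ?R g" and ga: "g a = x"
    using f g by (simp_all add: based_maps_def pcontinuous_pspace_of_topology_iff)
  have fR: "f s \<in> topspace ?R" and gR: "g s \<in> topspace ?R" if "s \<in> S" for s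
    using continuous_map_image_subset_topspace[OF fc] continuous_map_image_subset_topspace[OF gc] that
    by auto
  have x: "x \<in> topspace ?R"
    using fR[OF a] fa by simp
  have bx: "?b \<in> support x"
    by (rule vertex_choice_in_support[OF x])
  have bE: "(?b, ?b) \<in> E" and bX: "?b \<in> X"
    using x bx unfolding in_clique_realization_iff by (auto simp: clique_complex_def)
  obtain H where H: "pcontinuous (pspace_of_topology (top_of_set ?SI)) (graph_pspace X E) H"
    and H01: "\<And>s. s \<in> S \<Longrightarrow> H (s, 0) = vertex_choice (f s)" "\<And>s. s \<in> S \<Longrightarrow> H (s, 1) = vertex_choice (g s)"
    and Ha: "\<And>t. t \<in> ?I \<Longrightarrow> H (a, t) = ?b"
    using rel unfolding based_homotopy_rel_iff prod_topology_subtopology_eu by auto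
  have star: "\<exists>e>0. \<forall>s\<in>S. dist a s < e \<longrightarrow> support x \<subseteq> support (h s)"
    if h: "continuous_map (top_of_set S) ?R h" "h a = x" for h
  proof -
    have "openin (top_of_set S) {s \<in> topspace (top_of_set S). h s \<in> {t \<in> topspace ?R. support x \<subseteq> support t}}"
      by (intro openin_continuous_map_preimage[OF h(1)] openin_star finite_support[OF x])
    then obtain d where "d > 0" "\<forall>s\<in>S. dist s a < d \<longrightarrow> support x \<subseteq> support (h s)"
      using a h(2) x unfolding openin_euclidean_subtopology_iff by auto
    then show ?thesis
      by (auto simp: dist_commute)
  qed
  obtain e1 where e1: "e1 > 0" "\<And>s. s \<in> S \<Longrightarrow> dist a s < e1 \<Longrightarrow> support x \<subseteq> support (f s)"
    using star[OF fc fa] by blast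
  obtain e2 where e2: "e2 > 0" "\<And>s. s \<in> S \<Longrightarrow> dist a s < e2 \<Longrightarrow> support x \<subseteq> support (g s)"
    using star[OF gc ga] by blast
  obtain e3 where e3: "e3 > 0" "\<And>s t. s \<in> S \<Longrightarrow> t \<in> ?I \<Longrightarrow> dist a s < e3 \<Longrightarrow> (?b, H (s, t)) \<in> E"
  proof -
    have "\<forall>t\<in>?I. \<exists>e>0. \<forall>p\<in>?SI. dist (a, t) p < e \<longrightarrow> (?b, H p) \<in> E"
      using H a Ha unfolding iff by (metis SigmaI)
    then obtain r where r: "\<And>t. t \<in> ?I \<Longrightarrow> r t > 0"
      "\<And>t p. t \<in> ?I \<Longrightarrow> p \<in> ?SI \<Longrightarrow> dist (a, t) p < r t \<Longrightarrow> (?b, H p) \<in> E"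
      by metis
    \<comment> \<open>A Lebesgue number for the balls covering this segment makes the radius uniform
      in time.\<close>
    have "compact ({a} \<times> ?I)"
      by (intro compact_Times) auto
    moreover have "{a} \<times> ?I \<subseteq> (\<Union>t\<in>?I. ball (a, t) (r t))"
      using r(1) by force
    ultimately obtain e where e: "e > 0" "\<forall>p\<in>{a} \<times> ?I. \<exists>B\<in>(\<lambda>t. ball (a, t) (r t)) ` ?I. ball p e \<subseteq> B"
      by (rule Heine_Borel_lemma) auto
    have "(?b, H (s, t)) \<in> E" if st: "s \<in> S" "t \<in> ?I" "dist a s < e" for s t
    proof -
      have "\<exists>B\<in>(\<lambda>t. ball (a, t) (r t)) ` ?I. ball (a, t) e \<subseteq> B"
        using e(2) st(2) by blast
      then obtain t' where t': "t' \<in> ?I" "ball (a, t) e \<subseteq> ball (a, t') (r t')"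
        by blast
      have "dist (a, t) (s, t) < e"
        using st(3) by (simp add: dist_Pair_Pair)
      then have "dist (a, t') (s, t) < r t'"
        using t'(2) by (auto simp: subset_iff)
      then show ?thesis
        using r(2) t'(1) st by blast
    qed
    with e(1) show thesis
      by (rule that)
  qed
  \<comment> \<open>Half the minimum, so that points within \<open>d\<close> of the closed ball of
    radius \<open>d\<close> around \<open>a\<close> are still controlled.\<close>
  define d where "d = min e1 (min e2 e3) / 2"
  have d: "d > 0" and
    near: "\<And>s. s \<in> S \<Longrightarrow> dist a s < 2 * d \<Longrightarrow> support x \<subseteq> support (f s) \<and> support x \<subseteq> support (g s)"
    "\<And>s t. s \<in> S \<Longrightarrow> t \<in> ?I \<Longrightarrow> dist a s < 2 * d \<Longrightarrow> (?b, H (s, t)) \<in> E"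
    using e1 e2 e3 by (auto simp: d_def)
  define clamp :: "real \<Rightarrow> real" where "clamp t = max 0 (min 1 t)" for t
  have clamp_cont: "continuous_on A (\<lambda>p. clamp (h p))" if "continuous_on A h" for A and h :: "'a \<times> real \<Rightarrow> real"
    unfolding clamp_def using that by (intro continuous_intros)
  have clampI: "clamp t \<in> ?I" for t
    by (simp add: clamp_def)
  define C where "C = {p :: 'a \<times> real. dist a (fst p) \<le> d \<and> 1/3 \<le> snd p \<and> snd p \<le> 2/3}"
  \<comment> \<open>\<open>H\<close> runs during the middle third only; before and after,
    \<open>H'\<close> stays at the vertices chosen for \<open>f\<close> and
    \<open>g\<close>.\<close>
  define H' where "H' p = H (fst p, clamp (3 * snd p - 1))" for p
  define G where "G p = (if p \<in> C then ?b else H' p)" for p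
  have H'c: "pcontinuous (pspace_of_topology (top_of_set ?SI)) (graph_pspace X E) H'"
  proof -
    have "continuous_on ?SI (\<lambda>p. (fst p, clamp (3 * snd p - 1)))"
      by (intro continuous_intros clamp_cont)
    then have "continuous_map (top_of_set ?SI) (top_of_set ?SI) (\<lambda>p. (fst p, clamp (3 * snd p - 1)))"
      using clampI by auto
    from pcontinuous_compose_continuous_map[OF this H] show ?thesis
      by (simp add: H'_def[abs_def] o_def)
  qed
  have "closed C"
    unfolding C_def by (intro closed_Collect_conj closed_Collect_le continuous_intros)
  have Gc: "pcontinuous (pspace_of_topology (top_of_set ?SI)) (graph_pspace X E) G"
    unfolding iff
  proof (intro conjI ballI)
    show "G ` ?SI \<subseteq> X"
      using H'c bX unfolding iff by (auto simp: G_def)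
    fix p assume p: "p \<in> ?SI"
    show "\<exists>e>0. \<forall>q\<in>?SI. dist p q < e \<longrightarrow> (G p, G q) \<in> E"
    proof (cases "p \<in> C")
      case True
      have "(G p, G q) \<in> E" if q: "q \<in> ?SI" "dist p q < d" for q
      proof -
        have "dist a (fst q) < 2 * d"
          using True q(2) dist_triangle[of a "fst q" "fst p"] dist_fst_le[of p q] by (simp add: C_def)
        then have "(?b, H' q) \<in> E"
          using near(2)[of "fst q"] q(1) clampI by (auto simp: H'_def)
        then show ?thesis
          using True bE by (simp add: G_def)
      qed
      then show ?thesis
        using d by blast
    next
      case False
      then obtain e where e: "e > 0" "ball p e \<subseteq> - C"
        using \<open>closed C\<close> openE[of "- C" p] by (auto simp: open_Compl)
      obtain e' where e': "e' > 0" "\<forall>q\<in>?SI. dist p q < e' \<longrightarrow> (H' p, H' q) \<in> E"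
        using H'c p unfolding iff by blast
      show ?thesis
        using e e' False by (intro exI[of _ "min e e'"]) (auto simp: G_def subset_iff)
    qed
  qed
  \<comment> \<open>Equal to 1 up to time 1/4 and 0 from 1/3 on. Hence \<open>\<alpha> t\<close> and
    \<open>\<alpha> (1 - t)\<close> are never both nonzero, and \<open>F\<close> passes from
    \<open>f\<close> to \<open>x\<close> and later from \<open>x\<close> to
    \<open>g\<close>.\<close>
  define \<alpha> where "\<alpha> t = clamp (4 - 12 * t)" for t
  define F where "F p v = \<alpha> (snd p) * f (fst p) v + \<alpha> (1 - snd p) * g (fst p) v
      + (1 - \<alpha> (snd p) - \<alpha> (1 - snd p)) * x v" for p v
  \<comment> \<open>On \<open>?SI\<close> this vanishes exactly where the final homotopy is
    prescribed: at times 0 and 1 and over the base point. There \<open>l\<close> is 1.\<close>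
  define \<delta> where "\<delta> p = min (min (4 * snd p) (4 * (1 - snd p))) (dist a (fst p) / d)" for p
  define l where "l p = max 0 (1 - \<delta> p)" for p
  let ?N = "{p \<in> ?SI. \<delta> p \<le> 1}" and ?M = "{p \<in> ?SI. 1 \<le> \<delta> p}"
  have \<delta>c: "continuous_on A \<delta>" for A
    unfolding \<delta>_def using d by (intro continuous_intros) auto
  have SI: "compact ?SI"
    using S by (intro compact_Times) auto
  then have "closed ?SI"
    by (rule compact_imp_closed)
  moreover have "closed {p. \<delta> p \<le> 1}" "closed {p. 1 \<le> \<delta> p}"
    using \<delta>c by (intro closed_Collect_le continuous_intros; simp)+
  ultimately have cl: "closed ?N" "closed ?M"
    by (simp_all only: Collect_conj_eq Collect_mem_eq closed_Int)
  have \<alpha>: "0 \<le> \<alpha> t" "\<alpha> t \<le> 1" "t \<le> 1/4 \<Longrightarrow> \<alpha> t = 1" "t < 1/3 \<Longrightarrow> 0 < \<alpha> t" "1/3 \<le> t \<Longrightarrow> \<alpha> t = 0" for t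
    by (auto simp: \<alpha>_def clamp_def)
  \<comment> \<open>The witness \<open>y\<close> is the point whose simplex contains
    \<open>F (s, t)\<close>: \<open>f s\<close> in the first third of the time, \<open>x\<close> in
    the middle, \<open>g s\<close> in the last.\<close>
  have key: "\<exists>y\<in>{f s, g s, x}. F (s, t) \<in> closed_simplex (support y) \<and> support y \<in> clique_complex X E
      \<and> G (s, t) \<in> support (F (s, t))" if p: "(s, t) \<in> ?N" for s t
  proof -
    have s: "s \<in> S" and t: "t \<in> ?I"
      using p by auto
    \<comment> \<open>Between times 1/4 and 3/4 only the last term of \<open>\<delta>\<close> can be
      at most 1. So wherever \<open>F\<close> really mixes in \<open>x\<close>, the point
      \<open>s\<close> is near \<open>a\<close> and \<open>support x\<close> is contained in the
      other support.\<close>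
    have mid: "dist a s \<le> d" if "1/4 < t" "t < 3/4"
      using p that d by (auto simp: \<delta>_def min_le_iff_disj)
    have combine: "(\<lambda>v. \<alpha> u * y v + (1 - \<alpha> u) * x v) \<in> closed_simplex (support y)"
      if y: "y \<in> topspace ?R" and sub: "\<alpha> u \<noteq> 1 \<Longrightarrow> support x \<subseteq> support y" for y u
    proof (cases "\<alpha> u = 1")
      case True
      then show ?thesis
        using y by (simp add: in_clique_realization_iff)
    next
      case False
      have "x \<in> closed_simplex (support y)"
        using closed_simplex_mono[OF _ sub[OF False] finite_support[OF y]] x
        by (simp add: in_clique_realization_iff)
      moreover have "y \<in> closed_simplex (support y)"
        using y by (simp add: in_clique_realization_iff)
      ultimately show ?thesis
        using closed_simplex_convex[of x "support y" y "\<alpha> u"] \<alpha>(1,2) by (simp add: add.commute)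
    qed
    consider "t < 1/3" | "1/3 \<le> t" "t \<le> 2/3" | "2/3 < t"
      by linarith
    then show ?thesis
    proof cases
      case 1
      have F: "F (s, t) = (\<lambda>v. \<alpha> t * f s v + (1 - \<alpha> t) * x v)"
        using 1 \<alpha>(5)[of "1 - t"] by (simp add: F_def[abs_def])
      have "\<alpha> t \<noteq> 1 \<Longrightarrow> support x \<subseteq> support (f s)"
        using mid \<alpha>(3)[of t] 1 near(1)[OF s] d by force
      then have "F (s, t) \<in> closed_simplex (support (f s))"
        unfolding F by (rule combine[OF fR[OF s]])
      \<comment> \<open>\<open>C\<close> starts only at time 1/3 and \<open>H'\<close> rests until
        then. The coordinate of this vertex in \<open>F\<close> is positive because
        \<open>\<alpha> t\<close> is.\<close>
      moreover have "G (s, t) = vertex_choice (f s)"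
        using 1 H01(1)[OF s] by (simp add: G_def C_def H'_def clamp_def)
      then have "G (s, t) \<in> support (f s)"
        using vertex_choice_in_support[OF fR[OF s]] by simp
      then have "0 < \<alpha> t * f s (G (s, t))"
        using \<alpha>(4)[OF 1] by simp
      moreover have "0 \<le> x (G (s, t))"
        using x by (simp add: in_clique_realization_iff closed_simplex_def)
      then have "0 \<le> (1 - \<alpha> t) * x (G (s, t))"
        using \<alpha>(2)[of t] by simp
      ultimately show ?thesis
        using fR[OF s] by (auto simp: F in_clique_realization_iff)
    next
      case 2
      have "F (s, t) = x"
        using 2 \<alpha>(5)[of t] \<alpha>(5)[of "1 - t"] by (simp add: F_def[abs_def])
      moreover have "G (s, t) = ?b"
        using 2 mid by (simp add: G_def C_def)
      ultimately show ?thesis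
        using bx x by (simp add: in_clique_realization_iff)
    next
      case 3
      then have t3: "1 - t < 1/3"
        by simp
      have F: "F (s, t) = (\<lambda>v. \<alpha> (1 - t) * g s v + (1 - \<alpha> (1 - t)) * x v)"
        using 3 \<alpha>(5)[of t] by (simp add: F_def[abs_def])
      have "\<alpha> (1 - t) \<noteq> 1 \<Longrightarrow> support x \<subseteq> support (g s)"
        using mid \<alpha>(3)[of "1 - t"] 3 near(1)[OF s] d by force
      then have "F (s, t) \<in> closed_simplex (support (g s))"
        unfolding F by (rule combine[OF gR[OF s]])
      moreover have "G (s, t) = vertex_choice (g s)"
        using 3 H01(2)[OF s] by (simp add: G_def C_def H'_def clamp_def)
      then have "G (s, t) \<in> support (g s)"
        using vertex_choice_in_support[OF gR[OF s]] by simp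
      then have "0 < \<alpha> (1 - t) * g s (G (s, t))"
        using \<alpha>(4)[OF t3] by simp
      moreover have "0 \<le> x (G (s, t))"
        using x by (simp add: in_clique_realization_iff closed_simplex_def)
      then have "0 \<le> (1 - \<alpha> (1 - t)) * x (G (s, t))"
        using \<alpha>(2)[of "1 - t"] by simp
      ultimately show ?thesis
        using gR[OF s] by (auto simp: F in_clique_realization_iff)
    qed
  qed
  have "compact_space (top_of_set S)"
    using S by (simp add: compact_space_subtopology)
  then have fin: "finite (\<Union>s\<in>S. support (f s))" "finite (\<Union>s\<in>S. support (g s))"
    using finite_support_compact[OF _ fc] finite_support_compact[OF _ gc] by simp_all
  have Fc: "continuous_map (top_of_set ?N) ?R F"
  proof (rule continuous_map_into_clique_realization)
    let ?W = "(\<Union>s\<in>S. support (f s)) \<union> (\<Union>s\<in>S. support (g s)) \<union> support x"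
    show "finite ?W"
      using fin finite_support[OF x] by simp
    fix p assume "p \<in> topspace (top_of_set ?N)"
    then obtain s t where st: "p = (s, t)" "(s, t) \<in> ?N"
      by (cases p) simp
    obtain y where y: "y \<in> {f s, g s, x}" "F p \<in> closed_simplex (support y)" "support y \<in> clique_complex X E"
      using key[OF st(2)] st(1) by blast
    show "F p \<in> topspace ?R"
      using closed_simplex_in_clique_realization y by blast
    have "finite (support y)"
      using y(3) by (simp add: clique_complex_def)
    then have "support (F p) \<subseteq> support y"
      by (rule in_closed_simplex_support(1)[OF y(2)])
    then show "support (F p) \<subseteq> ?W"
      using y(1) st(2) by fastforce
  next
    fix v
    have fv: "continuous_on S (\<lambda>s. f s v)" and gv: "continuous_on S (\<lambda>s. g s v)"
      using continuous_map_compose[OF fc continuous_map_coordinate, of v]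
        continuous_map_compose[OF gc continuous_map_coordinate, of v] by (simp_all add: o_def)
    have "continuous_on ?N (\<lambda>p. f (fst p) v)" "continuous_on ?N (\<lambda>p. g (fst p) v)"
      by (rule continuous_on_compose2[OF fv] continuous_on_compose2[OF gv]; auto intro: continuous_intros)+
    then have "continuous_on ?N (\<lambda>p. F p v)"
      unfolding F_def \<alpha>_def by (intro continuous_intros clamp_cont)
    then show "continuous_map (top_of_set ?N) euclideanreal (\<lambda>p. F p v)"
      by simp
  qed
  have GF: "G p \<in> support (F p)" if "p \<in> ?N" for p
    using key[of "fst p" "snd p"] that by auto
  have lc: "continuous_on ?SI l"
    unfolding l_def using \<delta>c by (intro continuous_intros)
  have l01: "0 \<le> l p \<and> l p \<le> 1" if "p \<in> ?SI" for p
    using that d by (auto simp: l_def \<delta>_def)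
  have lM: "l p = 0" if "p \<in> ?M" for p
    using that by (simp add: l_def)
  have "?SI = ?N \<union> ?M"
    by auto
  then obtain K where K: "continuous_map (top_of_set ?SI) ?R K"
    "\<And>p. p \<in> ?SI \<Longrightarrow> l p = 1 \<Longrightarrow> K p = F p"
    using clique_approximation_extension[OF XE SI _ cl Gc Fc GF lc l01 lM] by metis
  have F0: "F (s, 0) = f s" "F (s, 1) = g s" "F (a, t) = x" for s t
    by (auto simp: F_def \<alpha>_def clamp_def fa ga fun_eq_iff algebra_simps)
  have "K (s, 0) = f s" "K (s, 1) = g s" if "s \<in> S" for s
    using K(2)[of "(s, 0)"] K(2)[of "(s, 1)"] that d by (simp_all add: F0 l_def \<delta>_def)
  moreover have "K (a, t) = x" if "t \<in> ?I" for t
    using K(2)[of "(a, t)"] that a by (simp add: F0 l_def \<delta>_def)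
  ultimately show ?thesis
    using f g K(1) unfolding based_homotopy_rel_iff prod_topology_subtopology_eu pcontinuous_pspace_of_topology_iff
    by (intro conjI exI[of _ K]) auto
qed

section \<open>Spheres\<close>

text \<open>The product topology on \<open>nat \<Rightarrow> real\<close> is the topology of its
  metric, so the results on compact metric spaces apply to spheres.\<close>

lemma nsphere_eq_top_of_set: "nsphere n = top_of_set (topspace (nsphere n))"
  by (simp add: nsphere euclidean_product_topology)

text \<open>A closed subset of a product of compact intervals.\<close>

lemma compact_nsphere: "compact (topspace (nsphere n))"
proof -
  \<comment> \<open>With the quantifier over all \<open>i\<close>, the sphere is an intersection of
    solution sets of continuous equations.\<close>
  have eq: "topspace (nsphere n) = {x. (\<Sum>i\<le>n. (x i)\<^sup>2) = 1 \<and> (\<forall>i. (if n < i then x i else 0) = 0)}"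
    by (auto simp: nsphere)
  have "continuous_on UNIV (\<lambda>x :: nat \<Rightarrow> real. if n < i then x i else 0)" for i
    by (cases "n < i") (auto intro: continuous_intros)
  then have "closed (topspace (nsphere n))"
    unfolding eq by (intro closed_Collect_conj closed_Collect_eq closed_Collect_all
        continuous_intros continuous_on_product_coordinates)
  then have "closedin (powertop_real UNIV) (topspace (nsphere n))"
    by (simp add: euclidean_product_topology)
  moreover have "compactin (powertop_real UNIV) (PiE UNIV (\<lambda>_. {-1..1}))"
    by (simp add: compactin_PiE)
  moreover have "topspace (nsphere n) \<subseteq> PiE UNIV (\<lambda>_. {-1..1})"
  proof
    fix x assume x: "x \<in> topspace (nsphere n)"
    have "\<bar>x i\<bar> \<le> 1" for i
    proof (cases "i \<le> n")
      case True
      then have "(x i)\<^sup>2 \<le> (\<Sum>i\<le>n. (x i)\<^sup>2)"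
        by (intro member_le_sum) auto
      then show ?thesis
        using x by (simp add: nsphere abs_square_le_1)
    qed (use x in \<open>simp add: nsphere\<close>)
    then show "x \<in> PiE UNIV (\<lambda>_. {-1..1})"
      by (simp add: PiE_iff abs_le_iff minus_le_iff)
  qed
  ultimately have "compactin (powertop_real UNIV) (topspace (nsphere n))"
    using closed_compactin by blast
  then show ?thesis
    by (simp add: euclidean_product_topology)
qed

theorem theorem2p7:
  fixes X :: "'v set" and E :: "('v \<times> 'v) set"
  assumes "reflexive_graph X E"
  shows "weakly_homotopy_equivalent
           (pspace_of_topology (geometric_realization (clique_complex X E)))
           (graph_pspace X E)"
proof -
  have T: "pseudotopological_space (graph_pspace X E)"
    using pretopological_graph_pspace[OF assms] by (simp add: pretopological_space_def)
  note S = pseudotopological_pspace_of_topology[of "clique_realization X E"]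
  have "weak_homotopy_equivalence (pspace_of_topology (clique_realization X E)) (graph_pspace X E)
      vertex_choice"
  proof (rule weak_homotopy_equivalenceI[OF S T pcontinuous_vertex_choice[OF assms]])
    fix n x
    let ?P = "topspace (nsphere n)"
    \<comment> \<open>The two lemmas on compact metric spaces are instantiated at the sphere and
      folded back to \<open>sphere_pspace n\<close>: \<open>lift\<close> gives surjectivity,
      \<open>refl\<close> injectivity.\<close>
    have P: "sphere_pspace n = pspace_of_topology (top_of_set ?P)"
      using nsphere_eq_top_of_set by metis
    note lift = vertex_choice_lift[OF assms compact_nsphere[of n] sphere_base_in_nsphere, folded P]
    note refl = vertex_choice_reflects_homotopy[OF assms compact_nsphere[of n] sphere_base_in_nsphere, folded P]
    assume "x \<in> points (pspace_of_topology (clique_realization X E))"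
    then have x: "x \<in> topspace (clique_realization X E)"
      by simp
    show "\<exists>k\<in>sphere_maps n (pspace_of_topology (clique_realization X E)) x.
        (g, vertex_choice \<circ> k) \<in> based_homotopy_rel (sphere_pspace n) sphere_base (graph_pspace X E) (vertex_choice x)"
      if "g \<in> sphere_maps n (graph_pspace X E) (vertex_choice x)" for g
      using lift[OF x that] by blast
    show "(f, g) \<in> based_homotopy_rel (sphere_pspace n) sphere_base (pspace_of_topology (clique_realization X E)) x"
      if "f \<in> sphere_maps n (pspace_of_topology (clique_realization X E)) x"
        "g \<in> sphere_maps n (pspace_of_topology (clique_realization X E)) x"
        "(vertex_choice \<circ> f, vertex_choice \<circ> g)
          \<in> based_homotopy_rel (sphere_pspace n) sphere_base (graph_pspace X E) (vertex_choice x)" for f g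
      using that by (rule refl)
  qed
  then show ?thesis
    using S T by (auto simp: weakly_homotopy_equivalent_def)
qed

end
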